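(* The full subcategory $\iota:\mathbf{CPMet}\subset\mathbf{CMet}$ is closed under colimits, and in particular $\mathbf{CPMet}$ is cocomplete. Furthermore, the inclusion functor $\iota$ is comonadic.
   Context: Metric spaces are allowed infinite distances: a metric takes values in $[0,\infty]$. $\mathbf{CMet}$ is the category of complete metric spaces with non-expansive (1-Lipschitz) maps as morphisms. The length of a continuous curve $f:[a,b]\to (X,d)$ is $\ell(f)=\sup\sum_i d(f(t_i),f(t_{i+1}))$ over all finite subdivisions $a=t_0\le t_1\le\cdots\le t_n=b$. The path metric attached to $d$ is $d_\ell(x,y)=\inf \ell(f)$ over all continuous curves $f:[a,b]\to X$ with $f(a)=x$, $f(b)=y$ (with $\inf\emptyset=\infty$). $(X,d)$ is a path metric space if $d=d_\ell$. $\mathbf{CPMet}$ is the full subcategory of $\mathbf{CMet}$ consisting of complete path metric spaces. A functor $F:\mathcal D\to\mathcal C$ is comonadic if it is isomorphic to the forgetful functor $\mathrm{Coalg}(T)\to\mathcal C$ from the category of coalgebras of some comonad $T$ on $\mathcal C$ (dual of monadic). *)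

theory Defs
  imports "HOL-Analysis.Analysis"
begin

unbundle cardinal_syntax

section \<open>Categories\<close>

record ('o, 'm) cat =
  Obj :: "'o set"
  Arr :: "'m set"
  Dom :: "'m \<Rightarrow> 'o"
  Cod :: "'m \<Rightarrow> 'o"
  Idt :: "'o \<Rightarrow> 'm"
  Comp :: "'m \<Rightarrow> 'm \<Rightarrow> 'm"  (infixl "\<cdot>\<index>" 70)

definition Hom :: "('o, 'm) cat \<Rightarrow> 'o \<Rightarrow> 'o \<Rightarrow> 'm set" where
  "Hom C X Y = {f \<in> Arr C. Dom C f = X \<and> Cod C f = Y}"

locale category =
  fixes C :: "('o, 'm) cat" (structure)
  assumes Dom_in: "f \<in> Arr C \<Longrightarrow> Dom C f \<in> Obj C"
    and Cod_in: "f \<in> Arr C \<Longrightarrow> Cod C f \<in> Obj C"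
    and Idt_in: "X \<in> Obj C \<Longrightarrow> Idt C X \<in> Hom C X X"
    and Comp_in: "f \<in> Hom C X Y \<Longrightarrow> g \<in> Hom C Y Z \<Longrightarrow> g \<cdot> f \<in> Hom C X Z"
    and Comp_Idt: "f \<in> Hom C X Y \<Longrightarrow> f \<cdot> Idt C X = f"
    and Idt_Comp: "f \<in> Hom C X Y \<Longrightarrow> Idt C Y \<cdot> f = f"
    and Comp_assoc: "f \<in> Hom C W X \<Longrightarrow> g \<in> Hom C X Y \<Longrightarrow> h \<in> Hom C Y Z \<Longrightarrow>
      (h \<cdot> g) \<cdot> f = h \<cdot> (g \<cdot> f)"

definition full_subcategory :: "('o, 'm) cat \<Rightarrow> 'o set \<Rightarrow> ('o, 'm) cat" where
  "full_subcategory C S =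
     C\<lparr>Obj := Obj C \<inter> S, Arr := {f \<in> Arr C. Dom C f \<in> S \<and> Cod C f \<in> S}\<rparr>"

text \<open>Only the values of the two components on objects and arrows of the source category are
  relevant.\<close>

record ('o, 'm, 'p, 'n) fnctr =
  Fob :: "'o \<Rightarrow> 'p"
  Far :: "'m \<Rightarrow> 'n"

definition id_fnctr :: "('o, 'm, 'o, 'm) fnctr" where
  "id_fnctr = \<lparr>Fob = (\<lambda>X. X), Far = (\<lambda>f. f)\<rparr>"

definition comp_fnctr ::
    "('p, 'n, 'q, 'l) fnctr \<Rightarrow> ('o, 'm, 'p, 'n) fnctr \<Rightarrow> ('o, 'm, 'q, 'l) fnctr" where
  "comp_fnctr G F = \<lparr>Fob = Fob G \<circ> Fob F, Far = Far G \<circ> Far F\<rparr>"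

locale is_fnctr = A: category A + B: category B
  for A :: "('o, 'm) cat" and B :: "('p, 'n) cat" +
  fixes F :: "('o, 'm, 'p, 'n) fnctr"
  assumes Fob_in: "X \<in> Obj A \<Longrightarrow> Fob F X \<in> Obj B"
    and Far_in: "f \<in> Hom A X Y \<Longrightarrow> Far F f \<in> Hom B (Fob F X) (Fob F Y)"
    and Far_Idt: "X \<in> Obj A \<Longrightarrow> Far F (Idt A X) = Idt B (Fob F X)"
    and Far_Comp: "f \<in> Hom A X Y \<Longrightarrow> g \<in> Hom A Y Z \<Longrightarrow>
      Far F (g \<cdot>\<^bsub>A\<^esub> f) = Far F g \<cdot>\<^bsub>B\<^esub> Far F f"

definition fnctr_eq_on ::
    "('o, 'm) cat \<Rightarrow> ('o, 'm, 'p, 'n) fnctr \<Rightarrow> ('o, 'm, 'p, 'n) fnctr \<Rightarrow> bool" where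
  "fnctr_eq_on A F G \<longleftrightarrow>
     (\<forall>X \<in> Obj A. Fob F X = Fob G X) \<and> (\<forall>f \<in> Arr A. Far F f = Far G f)"

definition is_nat_trans ::
    "('o, 'm) cat \<Rightarrow> ('p, 'n) cat \<Rightarrow> ('o, 'm, 'p, 'n) fnctr \<Rightarrow> ('o, 'm, 'p, 'n) fnctr \<Rightarrow>
     ('o \<Rightarrow> 'n) \<Rightarrow> bool" where
  "is_nat_trans A B F G \<eta> \<longleftrightarrow>
     is_fnctr A B F \<and> is_fnctr A B G \<and>
     (\<forall>X \<in> Obj A. \<eta> X \<in> Hom B (Fob F X) (Fob G X)) \<and>
     (\<forall>f \<in> Arr A. \<eta> (Cod A f) \<cdot>\<^bsub>B\<^esub> Far F f = Far G f \<cdot>\<^bsub>B\<^esub> \<eta> (Dom A f))"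

definition is_iso_of_cats ::
    "('o, 'm) cat \<Rightarrow> ('p, 'n) cat \<Rightarrow> ('o, 'm, 'p, 'n) fnctr \<Rightarrow> bool" where
  "is_iso_of_cats A B F \<longleftrightarrow>
     is_fnctr A B F \<and>
     (\<exists>G. is_fnctr B A G \<and>
          fnctr_eq_on A (comp_fnctr G F) id_fnctr \<and> fnctr_eq_on B (comp_fnctr F G) id_fnctr)"


section \<open>Colimits\<close>

definition is_cocone ::
    "('j, 'k) cat \<Rightarrow> ('o, 'm) cat \<Rightarrow> ('j, 'k, 'o, 'm) fnctr \<Rightarrow> 'o \<Rightarrow> ('j \<Rightarrow> 'm) \<Rightarrow> bool" where
  "is_cocone J C D c \<mu> \<longleftrightarrow>
     is_fnctr J C D \<and> c \<in> Obj C \<and>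
     (\<forall>j \<in> Obj J. \<mu> j \<in> Hom C (Fob D j) c) \<and>
     (\<forall>u \<in> Arr J. \<mu> (Cod J u) \<cdot>\<^bsub>C\<^esub> Far D u = \<mu> (Dom J u))"

definition is_colimit ::
    "('j, 'k) cat \<Rightarrow> ('o, 'm) cat \<Rightarrow> ('j, 'k, 'o, 'm) fnctr \<Rightarrow> 'o \<Rightarrow> ('j \<Rightarrow> 'm) \<Rightarrow> bool" where
  "is_colimit J C D c \<mu> \<longleftrightarrow>
     is_cocone J C D c \<mu> \<and>
     (\<forall>c' \<mu>'. is_cocone J C D c' \<mu>' \<longrightarrow>
        (\<exists>!h. h \<in> Hom C c c' \<and> (\<forall>j \<in> Obj J. h \<cdot>\<^bsub>C\<^esub> \<mu> j = \<mu>' j)))"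

definition has_colimits_of_shape :: "('j, 'k) cat \<Rightarrow> ('o, 'm) cat \<Rightarrow> bool" where
  "has_colimits_of_shape J C \<longleftrightarrow> (\<forall>D. is_fnctr J C D \<longrightarrow> (\<exists>c \<mu>. is_colimit J C D c \<mu>))"

text \<open>For a subcategory \<open>P\<close> of \<open>C\<close>; the inclusion functor is \<^const>\<open>id_fnctr\<close>.\<close>

definition closed_under_colimits_of_shape ::
    "('j, 'k) cat \<Rightarrow> ('o, 'm) cat \<Rightarrow> ('o, 'm) cat \<Rightarrow> bool" where
  "closed_under_colimits_of_shape J P C \<longleftrightarrow>
     (\<forall>D c \<mu>. is_fnctr J P D \<and> is_colimit J C (comp_fnctr id_fnctr D) c \<mu> \<longrightarrow> c \<in> Obj P)"


section \<open>Comonads\<close>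

definition is_comonad ::
    "('o, 'm) cat \<Rightarrow> ('o, 'm, 'o, 'm) fnctr \<Rightarrow> ('o \<Rightarrow> 'm) \<Rightarrow> ('o \<Rightarrow> 'm) \<Rightarrow> bool" where
  "is_comonad C T \<epsilon> \<delta> \<longleftrightarrow>
     is_nat_trans C C T id_fnctr \<epsilon> \<and>
     is_nat_trans C C T (comp_fnctr T T) \<delta> \<and>
     (\<forall>X \<in> Obj C.
        \<epsilon> (Fob T X) \<cdot>\<^bsub>C\<^esub> \<delta> X = Idt C (Fob T X) \<and>
        Far T (\<epsilon> X) \<cdot>\<^bsub>C\<^esub> \<delta> X = Idt C (Fob T X) \<and>
        Far T (\<delta> X) \<cdot>\<^bsub>C\<^esub> \<delta> X = \<delta> (Fob T X) \<cdot>\<^bsub>C\<^esub> \<delta> X)"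

definition is_coalgebra ::
    "('o, 'm) cat \<Rightarrow> ('o, 'm, 'o, 'm) fnctr \<Rightarrow> ('o \<Rightarrow> 'm) \<Rightarrow> ('o \<Rightarrow> 'm) \<Rightarrow> 'o \<Rightarrow> 'm \<Rightarrow> bool" where
  "is_coalgebra C T \<epsilon> \<delta> X \<alpha> \<longleftrightarrow>
     X \<in> Obj C \<and> \<alpha> \<in> Hom C X (Fob T X) \<and>
     \<epsilon> X \<cdot>\<^bsub>C\<^esub> \<alpha> = Idt C X \<and>
     \<delta> X \<cdot>\<^bsub>C\<^esub> \<alpha> = Far T \<alpha> \<cdot>\<^bsub>C\<^esub> \<alpha>"

text \<open>An arrow of coalgebras carries its source and target, so that it is a triple
  \<open>((X, \<alpha>), f, (Y, \<beta>))\<close>.\<close>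

definition Coalg ::
    "('o, 'm) cat \<Rightarrow> ('o, 'm, 'o, 'm) fnctr \<Rightarrow> ('o \<Rightarrow> 'm) \<Rightarrow> ('o \<Rightarrow> 'm) \<Rightarrow>
     ('o \<times> 'm, ('o \<times> 'm) \<times> 'm \<times> ('o \<times> 'm)) cat" where
  "Coalg C T \<epsilon> \<delta> =
     \<lparr>Obj = {(X, \<alpha>). is_coalgebra C T \<epsilon> \<delta> X \<alpha>},
      Arr = {((X, \<alpha>), f, (Y, \<beta>)) | X \<alpha> f Y \<beta>.
               is_coalgebra C T \<epsilon> \<delta> X \<alpha> \<and> is_coalgebra C T \<epsilon> \<delta> Y \<beta> \<and>
               f \<in> Hom C X Y \<and> \<beta> \<cdot>\<^bsub>C\<^esub> f = Far T f \<cdot>\<^bsub>C\<^esub> \<alpha>},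
      Dom = (\<lambda>(A, f, B). A),
      Cod = (\<lambda>(A, f, B). B),
      Idt = (\<lambda>A. (A, Idt C (fst A), A)),
      Comp = (\<lambda>(B', g, B'') (A, f, A'). (A, g \<cdot>\<^bsub>C\<^esub> f, B''))\<rparr>"

definition forget_coalg ::
    "('o \<times> 'm, ('o \<times> 'm) \<times> 'm \<times> ('o \<times> 'm), 'o, 'm) fnctr" where
  "forget_coalg = \<lparr>Fob = fst, Far = (\<lambda>(A, f, B). f)\<rparr>"

text \<open>\<open>F : D \<rightarrow> C\<close> is isomorphic, over \<open>C\<close>, to the forgetful functor from the coalgebras of some
  comonad on \<open>C\<close>.\<close>

definition comonadic ::
    "('p, 'n) cat \<Rightarrow> ('o, 'm) cat \<Rightarrow> ('p, 'n, 'o, 'm) fnctr \<Rightarrow> bool" where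
  "comonadic D C F \<longleftrightarrow>
     is_fnctr D C F \<and>
     (\<exists>T \<epsilon> \<delta> \<Phi>. is_comonad C T \<epsilon> \<delta> \<and> is_iso_of_cats D (Coalg C T \<epsilon> \<delta>) \<Phi> \<and>
        fnctr_eq_on D (comp_fnctr forget_coalg \<Phi>) F)"


section \<open>Metric spaces with possibly infinite distances\<close>

record 'a emet =
  Pts :: "'a set"
  edist :: "'a \<Rightarrow> 'a \<Rightarrow> ennreal"

text \<open>The last clause normalises the values of \<^const>\<open>edist\<close> outside the space, so that a space is
  determined by its points and the distances between them.\<close>

definition is_emet :: "'a emet \<Rightarrow> bool" where
  "is_emet X \<longleftrightarrow>
     (\<forall>x \<in> Pts X. \<forall>y \<in> Pts X. edist X x y = 0 \<longleftrightarrow> x = y) \<and>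
     (\<forall>x \<in> Pts X. \<forall>y \<in> Pts X. edist X x y = edist X y x) \<and>
     (\<forall>x \<in> Pts X. \<forall>y \<in> Pts X. \<forall>z \<in> Pts X. edist X x z \<le> edist X x y + edist X y z) \<and>
     (\<forall>x y. x \<notin> Pts X \<or> y \<notin> Pts X \<longrightarrow> edist X x y = 0)"

definition emet_Cauchy :: "'a emet \<Rightarrow> (nat \<Rightarrow> 'a) \<Rightarrow> bool" where
  "emet_Cauchy X \<sigma> \<longleftrightarrow>
     range \<sigma> \<subseteq> Pts X \<and> (\<forall>\<epsilon>>0. \<exists>N. \<forall>m\<ge>N. \<forall>n\<ge>N. edist X (\<sigma> m) (\<sigma> n) < \<epsilon>)"

definition emet_complete :: "'a emet \<Rightarrow> bool" where
  "emet_complete X \<longleftrightarrow>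
     (\<forall>\<sigma>. emet_Cauchy X \<sigma> \<longrightarrow> (\<exists>x \<in> Pts X. (\<lambda>n. edist X (\<sigma> n) x) \<longlonglongrightarrow> 0))"

definition is_curve :: "'a emet \<Rightarrow> real \<Rightarrow> real \<Rightarrow> (real \<Rightarrow> 'a) \<Rightarrow> bool" where
  "is_curve X a b f \<longleftrightarrow>
     a \<le> b \<and> f ` {a..b} \<subseteq> Pts X \<and>
     (\<forall>t \<in> {a..b}. ((\<lambda>s. edist X (f s) (f t)) \<longlongrightarrow> 0) (at t within {a..b}))"

definition curve_length :: "'a emet \<Rightarrow> real \<Rightarrow> real \<Rightarrow> (real \<Rightarrow> 'a) \<Rightarrow> ennreal" where
  "curve_length X a b f =
     Sup {\<Sum>i<n. edist X (f (t i)) (f (t (Suc i))) | n t.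
            t 0 = a \<and> t n = b \<and> (\<forall>i<n. t i \<le> t (Suc i))}"

definition path_dist :: "'a emet \<Rightarrow> 'a \<Rightarrow> 'a \<Rightarrow> ennreal" where
  "path_dist X x y =
     Inf {curve_length X a b f | a b f. is_curve X a b f \<and> f a = x \<and> f b = y}"

definition is_path_emet :: "'a emet \<Rightarrow> bool" where
  "is_path_emet X \<longleftrightarrow>
     is_emet X \<and> (\<forall>x \<in> Pts X. \<forall>y \<in> Pts X. edist X x y = path_dist X x y)"


section \<open>The categories \<open>CMet\<close> and \<open>CPMet\<close>\<close>

text \<open>The type \<open>'u\<close> plays the role of the universe of sets: \<open>small\<close> means of cardinality less
  than that of \<open>'u\<close>, and spaces have small subsets of \<open>'u\<close> as sets of points. The cardinal
  \<open>|'u|\<close> is required to be infinite, regular and closed under countable powers. Every strongly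
  inaccessible cardinal, i.e. every Grothendieck universe containing the set of natural numbers,
  qualifies, but so does for instance the successor cardinal of the continuum.\<close>

definition small :: "'u itself \<Rightarrow> 'a set \<Rightarrow> bool" where
  "small (_ :: 'u itself) A \<longleftrightarrow> |A| <o |UNIV :: 'u set|"

definition is_universe :: "'u itself \<Rightarrow> bool" where
  "is_universe (U :: 'u itself) \<longleftrightarrow>
     infinite (UNIV :: 'u set) \<and> regularCard |UNIV :: 'u set| \<and>
     (\<forall>A :: 'u set. small U A \<longrightarrow> small U {s :: nat \<Rightarrow> 'u. range s \<subseteq> A})"

definition small_category :: "'u itself \<Rightarrow> ('j, 'k) cat \<Rightarrow> bool" where
  "small_category U J \<longleftrightarrow> category J \<and> small U (Obj J) \<and> small U (Arr J)"

text \<open>An arrow \<open>(X, f, Y)\<close> is a non-expansive map \<open>f\<close> together with its source and target; being an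
  element of \<^const>\<open>PiE\<close>, \<open>f\<close> is determined by its values on \<^term>\<open>Pts X\<close>.\<close>

definition CMet :: "('u emet, 'u emet \<times> ('u \<Rightarrow> 'u) \<times> 'u emet) cat" where
  "CMet =
     (let Ob = {X. is_emet X \<and> emet_complete X \<and> small TYPE('u) (Pts X)} in
      \<lparr>Obj = Ob,
       Arr = {(X, f, Y) | X f Y. X \<in> Ob \<and> Y \<in> Ob \<and> f \<in> Pts X \<rightarrow>\<^sub>E Pts Y \<and>
                (\<forall>x \<in> Pts X. \<forall>y \<in> Pts X. edist Y (f x) (f y) \<le> edist X x y)},
       Dom = (\<lambda>(X, f, Y). X),
       Cod = (\<lambda>(X, f, Y). Y),
       Idt = (\<lambda>X. (X, (\<lambda>x \<in> Pts X. x), X)),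
       Comp = (\<lambda>(Y', g, Z) (X, f, Y). (X, compose (Pts X) g f, Z))\<rparr>)"

definition CPMet :: "('u emet, 'u emet \<times> ('u \<Rightarrow> 'u) \<times> 'u emet) cat" where
  "CPMet = full_subcategory CMet {X. is_path_emet X}"

end

theory Submission
  imports Defs
begin

text \<open>
  Replacing the distance of a complete space \<open>X\<close> by its path distance gives a space \<open>path_space X\<close> on
  the same points, and the identity map \<open>path_space X \<rightarrow> X\<close> is non-expansive. Once \<open>path_space X\<close> is
  known to be a complete path metric space, it is a coreflection of \<open>X\<close>: a non-expansive map does
  not lengthen curves, so a non-expansive map from a path metric space to \<open>X\<close> is also non-expansive
  for the path distance of \<open>X\<close>. Two of the three claims are then formal consequences, proved for an
  arbitrary coreflective subcategory (\<open>closed_under_colimits\<close>, \<open>comonadic_inclusion\<close>).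

  \<^item> Let \<open>c\<close> be a colimit, in the large category, of a diagram in the subcategory. Its legs factor
    through the counit \<open>L c \<rightarrow> c\<close>, the factorisations form a cocone, and the induced map \<open>c \<rightarrow> L c\<close>
    is a section of the counit. Hence \<open>c\<close> lies in the subcategory.
  \<^item> The coreflector is an idempotent comonad. A coalgebra structure on \<open>X\<close> is a section of the
    counit, so it exists exactly when \<open>X\<close> lies in the subcategory, and then it is unique.

  The metric content lies in the completeness of \<open>path_space X\<close> and in the fact that taking path
  distances twice changes nothing. Both become easy when curves are replaced by non-expansive maps
  on intervals \<open>[0, L]\<close>: two points have path distance less than \<open>L\<close> only if such a map joins them
  (\<open>lip_joined_of_short_curve\<close>, a reparametrisation by arc length), and if such a map joins them
  their path distance is at most \<open>L\<close>. A non-expansive map on \<open>[0, L]\<close> remains non-expansive for the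
  path distance, which gives idempotence. For completeness, a Cauchy sequence for the path distance
  is thinned out until consecutive terms are joined by intervals of lengths \<open>c, c/2, c/4, \<dots>\<close>; these
  are concatenated, and the limit point for the original distance closes the curve
  (\<open>lip_joined_limit\<close>).

  It remains to construct small colimits of complete metric spaces; by the first claim, for a diagram
  of path metric spaces the colimit is again a path metric space. Given a
  diagram, take the product of the vertices of all its cocones, with the supremum distance. The
  points of the diagram map to this product by their images under all cocones, and the closure of
  the set of these images is the colimit: the coordinate projections are the mediating maps, and
  they are unique because the images of the diagram are dense. The product is far too large to be
  an object of the category, but the closure is not: each of its points is the limit of a sequence
  in a small set, and the universe is closed under countable powers.
\<close>

section \<open>Full subcategories\<close>

lemma full_subcategory_simps [simp]:
  "Obj (full_subcategory C S) = Obj C \<inter> S"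
  "Dom (full_subcategory C S) = Dom C"
  "Cod (full_subcategory C S) = Cod C"
  "Idt (full_subcategory C S) = Idt C"
  "Comp (full_subcategory C S) = Comp C"
  by (simp_all add: full_subcategory_def)

lemma Arr_full_subcategory:
  "f \<in> Arr (full_subcategory C S) \<longleftrightarrow> f \<in> Arr C \<and> Dom C f \<in> S \<and> Cod C f \<in> S"
  by (simp add: full_subcategory_def)

lemma Hom_full_subcategory:
  "f \<in> Hom (full_subcategory C S) X Y \<longleftrightarrow> f \<in> Hom C X Y \<and> X \<in> S \<and> Y \<in> S"
  by (auto simp: Hom_def Arr_full_subcategory)

lemma comp_id_fnctr [simp]: "comp_fnctr id_fnctr F = F"
  by (simp add: comp_fnctr_def id_fnctr_def comp_def)

context category
begin

lemma Hom_Obj: "f \<in> Hom C X Y \<Longrightarrow> X \<in> Obj C \<and> Y \<in> Obj C"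
  using Dom_in Cod_in by (auto simp: Hom_def)

lemma category_full_subcategory: "category (full_subcategory C S)"
  by unfold_locales
    (auto simp: Hom_full_subcategory Arr_full_subcategory Dom_in Cod_in Idt_in Comp_Idt Idt_Comp
      intro: Comp_in Comp_assoc)

lemma id_fnctr_full_subcategory: "is_fnctr (full_subcategory C S) C id_fnctr"
  by (intro is_fnctr.intro category_full_subcategory category_axioms is_fnctr_axioms.intro)
    (auto simp: id_fnctr_def Hom_full_subcategory)

lemma fnctr_into_full_subcategory:
  "is_fnctr J (full_subcategory C S) D \<longleftrightarrow> is_fnctr J C D \<and> (\<forall>j \<in> Obj J. Fob D j \<in> S)"
proof
  assume "is_fnctr J (full_subcategory C S) D"
  then interpret D: is_fnctr J "full_subcategory C S" D .
  have "is_fnctr J C D"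
    using D.Fob_in D.Far_in D.Far_Idt D.Far_Comp
    by unfold_locales (auto simp: Hom_full_subcategory)
  then show "is_fnctr J C D \<and> (\<forall>j \<in> Obj J. Fob D j \<in> S)"
    using D.Fob_in by auto
next
  assume a: "is_fnctr J C D \<and> (\<forall>j \<in> Obj J. Fob D j \<in> S)"
  then interpret D: is_fnctr J C D by blast
  interpret P: category "full_subcategory C S" by (rule category_full_subcategory)
  show "is_fnctr J (full_subcategory C S) D"
    using a D.Fob_in D.Far_in D.Far_Idt D.Far_Comp
    by unfold_locales (auto simp: Hom_full_subcategory dest: D.A.Hom_Obj)
qed

lemma cocone_full_subcategory:
  assumes "is_fnctr J (full_subcategory C S) D"
  shows "is_cocone J (full_subcategory C S) D c \<mu> \<longleftrightarrow> is_cocone J C D c \<mu> \<and> c \<in> S"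
  using assms unfolding is_cocone_def fnctr_into_full_subcategory
  by (auto simp: Hom_full_subcategory)

text \<open>Fullness makes a colimit computed in the large category a colimit in the subcategory as soon as
  its vertex lies there.\<close>

lemma has_colimits_full_subcategory:
  assumes colims: "has_colimits_of_shape J C"
    and closed: "closed_under_colimits_of_shape J (full_subcategory C S) C"
  shows "has_colimits_of_shape J (full_subcategory C S)"
  unfolding has_colimits_of_shape_def
proof (intro allI impI)
  fix D assume D: "is_fnctr J (full_subcategory C S) D"
  then obtain c \<mu> where c: "is_colimit J C D c \<mu>"
    using colims unfolding has_colimits_of_shape_def fnctr_into_full_subcategory by blast
  then have "c \<in> S"
    using closed D unfolding closed_under_colimits_of_shape_def by fastforce
  then have "is_colimit J (full_subcategory C S) D c \<mu>"
    using c unfolding is_colimit_def cocone_full_subcategory[OF D]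
    by (simp add: Hom_full_subcategory)
  then show "\<exists>c \<mu>. is_colimit J (full_subcategory C S) D c \<mu>" by blast
qed

end


section \<open>The category of coalgebras of a comonad\<close>

lemma Coalg_simps [simp]:
  "A \<in> Obj (Coalg C T \<epsilon> \<delta>) \<longleftrightarrow> is_coalgebra C T \<epsilon> \<delta> (fst A) (snd A)"
  "Dom (Coalg C T \<epsilon> \<delta>) a = fst a"
  "Cod (Coalg C T \<epsilon> \<delta>) a = snd (snd a)"
  "Idt (Coalg C T \<epsilon> \<delta>) A = (A, Idt C (fst A), A)"
  "Comp (Coalg C T \<epsilon> \<delta>) b a = (fst a, fst (snd b) \<cdot>\<^bsub>C\<^esub> fst (snd a), snd (snd b))"
  by (auto simp: Coalg_def split: prod.splits)

lemma Hom_Coalg: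
  "a \<in> Hom (Coalg C T \<epsilon> \<delta>) A B \<longleftrightarrow>
    (\<exists>f. a = (A, f, B) \<and> is_coalgebra C T \<epsilon> \<delta> (fst A) (snd A) \<and>
      is_coalgebra C T \<epsilon> \<delta> (fst B) (snd B) \<and> f \<in> Hom C (fst A) (fst B) \<and>
      snd B \<cdot>\<^bsub>C\<^esub> f = Far T f \<cdot>\<^bsub>C\<^esub> snd A)"
  by (cases A, cases B) (auto simp: Hom_def Coalg_def)

lemma Arr_Hom: "f \<in> Arr C \<longleftrightarrow> f \<in> Hom C (Dom C f) (Cod C f)"
  by (simp add: Hom_def)

lemma category_Coalg:
  assumes "is_comonad C T \<epsilon> \<delta>"
  shows "category (Coalg C T \<epsilon> \<delta>)"
proof -
  interpret T: is_fnctr C C T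
    using assms by (simp add: is_comonad_def is_nat_trans_def)
  let ?K = "Coalg C T \<epsilon> \<delta>"
  have coalg_Hom: "X \<in> Obj C" "\<alpha> \<in> Hom C X (Fob T X)" if "is_coalgebra C T \<epsilon> \<delta> X \<alpha>" for X \<alpha>
    using that by (auto simp: is_coalgebra_def)
  show ?thesis
  proof
    fix X assume "X \<in> Obj ?K"
    then show "Idt ?K X \<in> Hom ?K X X"
      using coalg_Hom[of "fst X" "snd X"] T.A.Idt_in T.Far_Idt T.A.Comp_Idt T.A.Idt_Comp
      by (simp add: Hom_Coalg)
  next
    fix a b X Y Z assume "a \<in> Hom ?K X Y" "b \<in> Hom ?K Y Z"
    then obtain f g where a: "a = (X, f, Y)" and b: "b = (Y, g, Z)"
      and X: "is_coalgebra C T \<epsilon> \<delta> (fst X) (snd X)" and Y: "is_coalgebra C T \<epsilon> \<delta> (fst Y) (snd Y)"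
      and Z: "is_coalgebra C T \<epsilon> \<delta> (fst Z) (snd Z)"
      and f: "f \<in> Hom C (fst X) (fst Y)" and g: "g \<in> Hom C (fst Y) (fst Z)"
      and ff: "snd Y \<cdot>\<^bsub>C\<^esub> f = Far T f \<cdot>\<^bsub>C\<^esub> snd X" and gg: "snd Z \<cdot>\<^bsub>C\<^esub> g = Far T g \<cdot>\<^bsub>C\<^esub> snd Y"
      by (auto simp: Hom_Coalg)
    note x = coalg_Hom(2)[OF X] and y = coalg_Hom(2)[OF Y] and z = coalg_Hom(2)[OF Z]
    note Tf = T.Far_in[OF f] and Tg = T.Far_in[OF g]
    have "snd Z \<cdot>\<^bsub>C\<^esub> (g \<cdot>\<^bsub>C\<^esub> f) = (Far T g \<cdot>\<^bsub>C\<^esub> snd Y) \<cdot>\<^bsub>C\<^esub> f"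
      using T.A.Comp_assoc[OF f g z] gg by simp
    also have "\<dots> = (Far T g \<cdot>\<^bsub>C\<^esub> Far T f) \<cdot>\<^bsub>C\<^esub> snd X"
      using T.A.Comp_assoc[OF f y Tg] T.A.Comp_assoc[OF x Tf Tg] ff by simp
    finally show "b \<cdot>\<^bsub>?K\<^esub> a \<in> Hom ?K X Z"
      using X Z T.A.Comp_in[OF f g] T.Far_Comp[OF f g] by (simp add: Hom_Coalg a b)
  next
    fix a assume "a \<in> Arr ?K"
    then show "Dom ?K a \<in> Obj ?K" "Cod ?K a \<in> Obj ?K"
      unfolding Arr_Hom[of a ?K] Hom_Coalg by auto
  qed (auto simp: Hom_Coalg T.A.Comp_Idt T.A.Idt_Comp T.A.Comp_assoc)
qed


section \<open>Coreflective subcategories\<close>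

text \<open>
  A full subcategory on the objects \<open>S\<close> is coreflective when each object \<open>X\<close> has a universal arrow
  \<open>\<epsilon> X : L X \<rightarrow> X\<close> from an object of \<open>S\<close>. The last assumption is a form of closure under isomorphism: a
  section \<open>s\<close> of \<open>\<epsilon> X\<close> also satisfies \<open>s \<cdot> \<epsilon> X = Idt C (L X)\<close>, since both sides have the same composite
  with \<open>\<epsilon> X\<close>, so that \<open>X\<close> is isomorphic to \<open>L X\<close>.
\<close>

locale coreflective_subcategory = category C
  for C :: "('o, 'm) cat" (structure) +
  fixes S :: "'o set" and L :: "'o \<Rightarrow> 'o" and \<epsilon> :: "'o \<Rightarrow> 'm"
  assumes L_in: "X \<in> Obj C \<Longrightarrow> L X \<in> Obj C \<inter> S"
    and counit_in: "X \<in> Obj C \<Longrightarrow> \<epsilon> X \<in> Hom C (L X) X"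
    and counit_universal: "f \<in> Hom C P X \<Longrightarrow> P \<in> S \<Longrightarrow> \<exists>!g. g \<in> Hom C P (L X) \<and> \<epsilon> X \<cdot> g = f"
    and counit_split: "s \<in> Hom C X (L X) \<Longrightarrow> \<epsilon> X \<cdot> s = Idt C X \<Longrightarrow> X \<in> S"
begin

definition lift :: "'o \<Rightarrow> 'o \<Rightarrow> 'm \<Rightarrow> 'm" where
  "lift P X f = (THE g. g \<in> Hom C P (L X) \<and> \<epsilon> X \<cdot> g = f)"

lemma lift_in: "f \<in> Hom C P X \<Longrightarrow> P \<in> S \<Longrightarrow> lift P X f \<in> Hom C P (L X)"
  and counit_lift: "f \<in> Hom C P X \<Longrightarrow> P \<in> S \<Longrightarrow> \<epsilon> X \<cdot> lift P X f = f"
  using theI'[OF counit_universal, of f P X] by (auto simp: lift_def)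

text \<open>The counit is monic with respect to arrows from \<open>S\<close>. Every equation between arrows into some
  \<open>L X\<close> below is proved by composing both sides with the counit.\<close>

lemma counit_cancel:
  assumes "g \<in> Hom C P (L X)" "h \<in> Hom C P (L X)" "\<epsilon> X \<cdot> g = \<epsilon> X \<cdot> h" "P \<in> S" "X \<in> Obj C"
  shows "g = h"
  using counit_universal[OF Comp_in[OF assms(1) counit_in] assms(4)] assms by metis

text \<open>The legs lift to a cocone over \<open>L c\<close>; by the uniqueness part of the universal property of
  \<open>c\<close>, the induced arrow \<open>c \<rightarrow> L c\<close> is a section of the counit.\<close>

theorem closed_under_colimits:
  "closed_under_colimits_of_shape J (full_subcategory C S) C"
  unfolding closed_under_colimits_of_shape_def comp_id_fnctr
proof (intro allI impI, elim conjE)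
  fix D c \<mu>
  assume D: "is_fnctr J (full_subcategory C S) D" and colim: "is_colimit J C D c \<mu>"
  have DC: "is_fnctr J C D" and DS: "\<And>j. j \<in> Obj J \<Longrightarrow> Fob D j \<in> S"
    using D by (auto simp: fnctr_into_full_subcategory)
  interpret D: is_fnctr J C D by (fact DC)
  have c: "c \<in> Obj C"
    and \<mu>: "\<And>j. j \<in> Obj J \<Longrightarrow> \<mu> j \<in> Hom C (Fob D j) c"
    and nat: "\<And>u. u \<in> Arr J \<Longrightarrow> \<mu> (Cod J u) \<cdot> Far D u = \<mu> (Dom J u)"
    using colim by (auto simp: is_colimit_def is_cocone_def)
  define \<nu> where "\<nu> j = lift (Fob D j) c (\<mu> j)" for j
  have \<nu>: "\<nu> j \<in> Hom C (Fob D j) (L c)" "\<epsilon> c \<cdot> \<nu> j = \<mu> j" if "j \<in> Obj J" for j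
    unfolding \<nu>_def using lift_in[OF \<mu> DS] counit_lift[OF \<mu> DS] that by blast+
  have Lc: "L c \<in> Obj C" using L_in[OF c] by blast
  have "\<nu> (Cod J u) \<cdot> Far D u = \<nu> (Dom J u)" if u: "u \<in> Arr J" for u
  proof -
    have j: "Dom J u \<in> Obj J" "Cod J u \<in> Obj J" and Du: "Far D u \<in> Hom C (Fob D (Dom J u)) (Fob D (Cod J u))"
      using u D.A.Dom_in D.A.Cod_in D.Far_in by (auto simp: Arr_Hom[of u])
    have "\<epsilon> c \<cdot> (\<nu> (Cod J u) \<cdot> Far D u) = \<epsilon> c \<cdot> \<nu> (Dom J u)"
      using Comp_assoc[OF Du \<nu>(1)[OF j(2)] counit_in[OF c]] \<nu>(2) j nat[OF u] by simp
    then show ?thesis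
      using counit_cancel[OF Comp_in[OF Du \<nu>(1)[OF j(2)]] \<nu>(1)[OF j(1)]] DS[OF j(1)] c by blast
  qed
  then have "is_cocone J C D (L c) \<nu>"
    using DC Lc \<nu>(1) by (auto simp: is_cocone_def)
  then obtain h where h: "h \<in> Hom C c (L c)" "\<And>j. j \<in> Obj J \<Longrightarrow> h \<cdot> \<mu> j = \<nu> j"
    using colim unfolding is_colimit_def by blast
  have "\<epsilon> c \<cdot> h \<in> Hom C c c" "\<forall>j \<in> Obj J. (\<epsilon> c \<cdot> h) \<cdot> \<mu> j = \<mu> j"
    using Comp_in[OF h(1) counit_in[OF c]] Comp_assoc[OF \<mu> h(1) counit_in[OF c]] h(2) \<nu>(2)
    by simp_all
  moreover have "Idt C c \<in> Hom C c c" "\<forall>j \<in> Obj J. Idt C c \<cdot> \<mu> j = \<mu> j"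
    using Idt_in[OF c] Idt_Comp[OF \<mu>] by auto
  moreover have "\<exists>!h. h \<in> Hom C c c \<and> (\<forall>j \<in> Obj J. h \<cdot> \<mu> j = \<mu> j)"
    using colim unfolding is_colimit_def by blast
  ultimately have "\<epsilon> c \<cdot> h = Idt C c" by blast
  then have "c \<in> S" using counit_split h(1) by blast
  then show "c \<in> Obj (full_subcategory C S)" using c by simp
qed

text \<open>The comonad on \<open>C\<close> given by the coreflector, with comultiplication \<open>\<delta>\<close>.\<close>

definition T :: "('o, 'm, 'o, 'm) fnctr" where
  "T = \<lparr>Fob = L, Far = (\<lambda>f. lift (L (Dom C f)) (Cod C f) (f \<cdot> \<epsilon> (Dom C f)))\<rparr>"

definition \<delta> :: "'o \<Rightarrow> 'm" where
  "\<delta> X = lift (L X) (L X) (Idt C (L X))"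

lemma Fob_T [simp]: "Fob T = L"
  by (simp add: T_def)

lemma
  assumes f: "f \<in> Hom C X Y"
  shows Far_T_in: "Far T f \<in> Hom C (L X) (L Y)"
    and counit_Far_T: "\<epsilon> Y \<cdot> Far T f = f \<cdot> \<epsilon> X"
proof -
  have X: "X \<in> Obj C" "Dom C f = X" "Cod C f = Y" using f Hom_Obj by (auto simp: Hom_def)
  have LS: "L X \<in> S" using L_in X by blast
  have fe: "f \<cdot> \<epsilon> X \<in> Hom C (L X) Y" using Comp_in[OF counit_in f] X by blast
  show "Far T f \<in> Hom C (L X) (L Y)" "\<epsilon> Y \<cdot> Far T f = f \<cdot> \<epsilon> X"
    using lift_in[OF fe LS] counit_lift[OF fe LS] X by (simp_all add: T_def)
qed

lemma
  assumes X: "X \<in> Obj C"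
  shows \<delta>_in: "\<delta> X \<in> Hom C (L X) (L (L X))"
    and counit_\<delta>: "\<epsilon> (L X) \<cdot> \<delta> X = Idt C (L X)"
  using lift_in[OF Idt_in] counit_lift[OF Idt_in] L_in[OF X] by (auto simp: \<delta>_def)

lemma is_fnctr_T: "is_fnctr C C T"
proof
  fix X assume X: "X \<in> Obj C"
  then show "Fob T X \<in> Obj C" using L_in by simp
  have LX: "L X \<in> Obj C" "L X \<in> S" using L_in[OF X] by auto
  show "Far T (Idt C X) = Idt C (Fob T X)"
    using counit_cancel[OF Far_T_in[OF Idt_in[OF X]] Idt_in[OF LX(1)] _ LX(2) X]
      counit_Far_T[OF Idt_in[OF X]] Idt_Comp[OF counit_in[OF X]] Comp_Idt[OF counit_in[OF X]]
    by simp
next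
  fix f X Y assume "f \<in> Hom C X Y"
  then show "Far T f \<in> Hom C (Fob T X) (Fob T Y)" using Far_T_in by simp
next
  fix f g X Y Z assume f: "f \<in> Hom C X Y" and g: "g \<in> Hom C Y Z"
  have X: "X \<in> Obj C" and Y: "Y \<in> Obj C" and Z: "Z \<in> Obj C"
    using Hom_Obj[OF f] Hom_Obj[OF g] by auto
  have LX: "L X \<in> S" using L_in[OF X] by auto
  note Tf = Far_T_in[OF f] and Tg = Far_T_in[OF g] and gf = Comp_in[OF f g]
  have "\<epsilon> Z \<cdot> (Far T g \<cdot> Far T f) = (g \<cdot> \<epsilon> Y) \<cdot> Far T f"
    using Comp_assoc[OF Tf Tg counit_in[OF Z]] counit_Far_T[OF g] by simp
  also have "\<dots> = g \<cdot> (f \<cdot> \<epsilon> X)"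
    using Comp_assoc[OF Tf counit_in[OF Y] g] counit_Far_T[OF f] by simp
  also have "\<dots> = \<epsilon> Z \<cdot> Far T (g \<cdot> f)"
    using Comp_assoc[OF counit_in[OF X] f g] counit_Far_T[OF gf] by simp
  finally show "Far T (g \<cdot> f) = Far T g \<cdot> Far T f"
    using counit_cancel[OF Far_T_in[OF gf] Comp_in[OF Tf Tg] _ LX Z] by simp
qed

lemma is_comonad_T: "is_comonad C T \<epsilon> \<delta>"
proof -
  interpret T: is_fnctr C C T by (rule is_fnctr_T)
  have id: "is_fnctr C C id_fnctr" by unfold_locales (auto simp: id_fnctr_def)
  have Fob_TT: "Fob (comp_fnctr T T) X = L (L X)" and Far_TT: "Far (comp_fnctr T T) f = Far T (Far T f)"
    for X f by (simp_all add: comp_fnctr_def)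
  have TT: "is_fnctr C C (comp_fnctr T T)"
  proof
    fix X assume X: "X \<in> Obj C"
    then have LX: "L X \<in> Obj C" using L_in by blast
    then show "Fob (comp_fnctr T T) X \<in> Obj C" using L_in by (simp add: Fob_TT)
    show "Far (comp_fnctr T T) (Idt C X) = Idt C (Fob (comp_fnctr T T) X)"
      using T.Far_Idt[OF X] T.Far_Idt[OF LX] by (simp add: Fob_TT Far_TT)
  qed (auto simp: Fob_TT Far_TT T.Far_Comp[OF Far_T_in Far_T_in] T.Far_Comp intro: Far_T_in)
  have nat_\<epsilon>: "is_nat_trans C C T id_fnctr \<epsilon>"
    unfolding is_nat_trans_def using is_fnctr_T id counit_in counit_Far_T
    by (auto simp: id_fnctr_def Arr_Hom)
  have "\<delta> Y \<cdot> Far T f = Far T (Far T f) \<cdot> \<delta> X" if f: "f \<in> Hom C X Y" for f X Y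
  proof -
    have X: "X \<in> Obj C" and Y: "Y \<in> Obj C" using Hom_Obj[OF f] by auto
    have LX: "L X \<in> Obj C" "L X \<in> S" and LY: "L Y \<in> Obj C" using L_in[OF X] L_in[OF Y] by auto
    note Tf = Far_T_in[OF f] and TTf = Far_T_in[OF Far_T_in[OF f]]
    have "\<epsilon> (L Y) \<cdot> (\<delta> Y \<cdot> Far T f) = Far T f"
      using Comp_assoc[OF Tf \<delta>_in[OF Y] counit_in[OF LY]] counit_\<delta>[OF Y] Idt_Comp[OF Tf] by simp
    moreover have "\<epsilon> (L Y) \<cdot> (Far T (Far T f) \<cdot> \<delta> X) = (Far T f \<cdot> \<epsilon> (L X)) \<cdot> \<delta> X"
      using Comp_assoc[OF \<delta>_in[OF X] TTf counit_in[OF LY]] counit_Far_T[OF Tf] by simp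
    moreover have "\<dots> = Far T f"
      using Comp_assoc[OF \<delta>_in[OF X] counit_in[OF LX(1)] Tf] counit_\<delta>[OF X] Comp_Idt[OF Tf] by simp
    ultimately show ?thesis
      using counit_cancel[OF Comp_in[OF Tf \<delta>_in[OF Y]] Comp_in[OF \<delta>_in[OF X] TTf] _ LX(2) LY] by simp
  qed
  then have nat_\<delta>: "is_nat_trans C C T (comp_fnctr T T) \<delta>"
    unfolding is_nat_trans_def using is_fnctr_T TT \<delta>_in
    by (auto simp: Fob_TT Far_TT Arr_Hom)
  have "Far T (\<epsilon> X) \<cdot> \<delta> X = Idt C (L X) \<and> Far T (\<delta> X) \<cdot> \<delta> X = \<delta> (L X) \<cdot> \<delta> X"
    if X: "X \<in> Obj C" for X
  proof -
    have LX: "L X \<in> Obj C" "L X \<in> S" and LLX: "L (L X) \<in> Obj C" using L_in X by auto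
    note e = counit_in[OF X] and d = \<delta>_in[OF X] and e' = counit_in[OF LX(1)]
      and d' = \<delta>_in[OF LX(1)] and e'' = counit_in[OF LLX]
    note Te = Far_T_in[OF e] and Td = Far_T_in[OF d]
    have "\<epsilon> X \<cdot> (Far T (\<epsilon> X) \<cdot> \<delta> X) = \<epsilon> X \<cdot> Idt C (L X)"
      using Comp_assoc[OF d Te e] counit_Far_T[OF e] Comp_assoc[OF d e' e] counit_\<delta>[OF X] by simp
    then have 1: "Far T (\<epsilon> X) \<cdot> \<delta> X = Idt C (L X)"
      using counit_cancel[OF Comp_in[OF d Te] Idt_in[OF LX(1)] _ LX(2) X] by simp
    have "\<epsilon> (L (L X)) \<cdot> (Far T (\<delta> X) \<cdot> \<delta> X) = \<delta> X"
      using Comp_assoc[OF d Td e''] counit_Far_T[OF d] Comp_assoc[OF d e' d] counit_\<delta>[OF X]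
        Comp_Idt[OF d] by simp
    moreover have "\<epsilon> (L (L X)) \<cdot> (\<delta> (L X) \<cdot> \<delta> X) = \<delta> X"
      using Comp_assoc[OF d d' e''] counit_\<delta>[OF LX(1)] Idt_Comp[OF d] by simp
    ultimately show ?thesis
      using counit_cancel[OF Comp_in[OF d Td] Comp_in[OF d d'] _ LX(2) LLX] 1 by simp
  qed
  then show ?thesis
    unfolding is_comonad_def using nat_\<epsilon> nat_\<delta> counit_\<delta> by simp
qed

text \<open>The unit of the coreflection at an object of \<open>S\<close>: the coalgebra structure of that object.\<close>

definition \<eta> :: "'o \<Rightarrow> 'm" where
  "\<eta> X = lift X X (Idt C X)"

lemma
  assumes X: "X \<in> Obj C" "X \<in> S"
  shows \<eta>_in: "\<eta> X \<in> Hom C X (L X)"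
    and counit_\<eta>: "\<epsilon> X \<cdot> \<eta> X = Idt C X"
  using lift_in[OF Idt_in] counit_lift[OF Idt_in] X by (auto simp: \<eta>_def)

text \<open>The counit law of a coalgebra already says that its structure map is a section of the counit,
  which forces \<open>X \<in> S\<close> and determines the structure map. Conversely \<open>\<eta> X\<close> is coassociative because both
  composites become \<open>\<eta> X\<close> after applying the counit.\<close>

lemma is_coalgebra_iff:
  "is_coalgebra C T \<epsilon> \<delta> X \<alpha> \<longleftrightarrow> X \<in> Obj C \<and> X \<in> S \<and> \<alpha> = \<eta> X"
proof
  assume "is_coalgebra C T \<epsilon> \<delta> X \<alpha>"
  then have a: "X \<in> Obj C" "\<alpha> \<in> Hom C X (L X)" "\<epsilon> X \<cdot> \<alpha> = Idt C X"
    by (auto simp: is_coalgebra_def)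
  then have "X \<in> S" using counit_split by blast
  with a show "X \<in> Obj C \<and> X \<in> S \<and> \<alpha> = \<eta> X"
    using counit_cancel[OF a(2) \<eta>_in] counit_\<eta> by simp
next
  assume a: "X \<in> Obj C \<and> X \<in> S \<and> \<alpha> = \<eta> X"
  then have X: "X \<in> Obj C" "X \<in> S" and LX: "L X \<in> Obj C" using L_in by auto
  note h = \<eta>_in[OF X] and e = counit_in[OF X(1)] and d = \<delta>_in[OF X(1)] and e' = counit_in[OF LX]
  note Th = Far_T_in[OF h]
  have "\<epsilon> (L X) \<cdot> (\<delta> X \<cdot> \<eta> X) = \<eta> X"
    using Comp_assoc[OF h d e'] counit_\<delta>[OF X(1)] Idt_Comp[OF h] by simp
  moreover have "\<epsilon> (L X) \<cdot> (Far T (\<eta> X) \<cdot> \<eta> X) = \<eta> X"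
    using Comp_assoc[OF h Th e'] counit_Far_T[OF h] Comp_assoc[OF h e h] counit_\<eta>[OF X] Comp_Idt[OF h]
    by simp
  ultimately have "\<delta> X \<cdot> \<eta> X = Far T (\<eta> X) \<cdot> \<eta> X"
    using counit_cancel[OF Comp_in[OF h d] Comp_in[OF h Th] _ X(2) LX] by simp
  then show "is_coalgebra C T \<epsilon> \<delta> X \<alpha>"
    using a h counit_\<eta>[OF X] by (simp add: is_coalgebra_def)
qed

lemma coalgebra_arrow:
  assumes f: "f \<in> Hom C X Y" and S: "X \<in> S" "Y \<in> S"
  shows "\<eta> Y \<cdot> f = Far T f \<cdot> \<eta> X"
proof -
  have X: "X \<in> Obj C" and Y: "Y \<in> Obj C" using Hom_Obj[OF f] by auto
  note hX = \<eta>_in[OF X S(1)] and hY = \<eta>_in[OF Y S(2)] and Tf = Far_T_in[OF f]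
  have "\<epsilon> Y \<cdot> (\<eta> Y \<cdot> f) = f"
    using Comp_assoc[OF f hY counit_in[OF Y]] counit_\<eta>[OF Y S(2)] Idt_Comp[OF f] by simp
  moreover have "\<epsilon> Y \<cdot> (Far T f \<cdot> \<eta> X) = f"
    using Comp_assoc[OF hX Tf counit_in[OF Y]] counit_Far_T[OF f] Comp_assoc[OF hX counit_in[OF X] f]
      counit_\<eta>[OF X S(1)] Comp_Idt[OF f] by simp
  ultimately show ?thesis
    using counit_cancel[OF Comp_in[OF f hY] Comp_in[OF hX Tf] _ S(1) Y] by simp
qed

text \<open>Objects and arrows of the subcategory carry exactly one coalgebra structure, so forgetting the
  structure is inverse to adding it.\<close>

theorem comonadic_inclusion: "comonadic (full_subcategory C S) C id_fnctr"
proof -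
  let ?P = "full_subcategory C S" and ?K = "Coalg C T \<epsilon> \<delta>"
  define \<Phi> :: "('o, 'm, 'o \<times> 'm, ('o \<times> 'm) \<times> 'm \<times> ('o \<times> 'm)) fnctr" where
    "\<Phi> = \<lparr>Fob = (\<lambda>X. (X, \<eta> X)),
      Far = (\<lambda>f. ((Dom C f, \<eta> (Dom C f)), f, (Cod C f, \<eta> (Cod C f))))\<rparr>"
  interpret P: category ?P by (rule category_full_subcategory)
  interpret K: category ?K by (rule category_Coalg[OF is_comonad_T])
  have \<Phi>: "is_fnctr ?P ?K \<Phi>"
  proof
    fix f g X Y Z assume "f \<in> Hom ?P X Y" "g \<in> Hom ?P Y Z"
    then show "Far \<Phi> (g \<cdot>\<^bsub>?P\<^esub> f) = Far \<Phi> g \<cdot>\<^bsub>?K\<^esub> Far \<Phi> f"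
      using Comp_in[of f X Y g Z] by (auto simp: \<Phi>_def Hom_def Arr_full_subcategory)
  next
    fix X assume "X \<in> Obj ?P"
    then show "Far \<Phi> (Idt ?P X) = Idt ?K (Fob \<Phi> X)"
      using Idt_in[of X] by (auto simp: \<Phi>_def Hom_def)
  next
    fix f X Y assume "f \<in> Hom ?P X Y"
    then have f: "f \<in> Hom C X Y" "X \<in> S" "Y \<in> S" by (auto simp: Hom_full_subcategory)
    then show "Far \<Phi> f \<in> Hom ?K (Fob \<Phi> X) (Fob \<Phi> Y)"
      using Hom_Obj[OF f(1)] coalgebra_arrow[OF f]
      by (auto simp: \<Phi>_def Hom_Coalg is_coalgebra_iff) (auto simp: Hom_def)
  qed (auto simp: \<Phi>_def is_coalgebra_iff)
  have forget: "is_fnctr ?K ?P forget_coalg"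
    by unfold_locales
      (auto simp: forget_coalg_def Hom_Coalg Hom_full_subcategory is_coalgebra_iff split: prod.splits)
  have "is_iso_of_cats ?P ?K \<Phi>"
    unfolding is_iso_of_cats_def
  proof (intro conjI exI[of _ forget_coalg] \<Phi> forget)
    show "fnctr_eq_on ?P (comp_fnctr forget_coalg \<Phi>) id_fnctr"
      by (simp add: fnctr_eq_on_def comp_fnctr_def forget_coalg_def \<Phi>_def id_fnctr_def)
    have "Far \<Phi> (Far forget_coalg a) = a" if "a \<in> Arr ?K" for a
      using that unfolding Arr_Hom[of a ?K] Hom_Coalg is_coalgebra_iff
      by (cases a) (auto simp: forget_coalg_def \<Phi>_def Hom_def)
    then show "fnctr_eq_on ?K (comp_fnctr \<Phi> forget_coalg) id_fnctr"
      by (auto simp: fnctr_eq_on_def comp_fnctr_def id_fnctr_def is_coalgebra_iff forget_coalg_def \<Phi>_def)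
  qed
  moreover have "fnctr_eq_on ?P (comp_fnctr forget_coalg \<Phi>) id_fnctr"
    by (simp add: fnctr_eq_on_def comp_fnctr_def forget_coalg_def \<Phi>_def id_fnctr_def)
  ultimately show ?thesis
    unfolding comonadic_def using id_fnctr_full_subcategory is_comonad_T by blast
qed

end


section \<open>Spaces with possibly infinite distances\<close>

lemma emet_same [simp]: "is_emet X \<Longrightarrow> edist X x x = 0"
  unfolding is_emet_def by blast

lemma emet_eq: "is_emet X \<Longrightarrow> x \<in> Pts X \<Longrightarrow> y \<in> Pts X \<Longrightarrow> edist X x y = 0 \<Longrightarrow> x = y"
  unfolding is_emet_def by blast

lemma emet_sym: "is_emet X \<Longrightarrow> edist X x y = edist X y x"
  unfolding is_emet_def by (cases "x \<in> Pts X \<and> y \<in> Pts X") auto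

lemma emet_triangle:
  "is_emet X \<Longrightarrow> x \<in> Pts X \<Longrightarrow> y \<in> Pts X \<Longrightarrow> z \<in> Pts X \<Longrightarrow>
    edist X x z \<le> edist X x y + edist X y z"
  unfolding is_emet_def by blast

lemma tendsto_0_ennreal_iff:
  fixes f :: "'a \<Rightarrow> ennreal"
  shows "(f \<longlongrightarrow> 0) F \<longleftrightarrow> (\<forall>e::real. e > 0 \<longrightarrow> eventually (\<lambda>x. f x \<le> ennreal e) F)"
proof
  assume f: "(f \<longlongrightarrow> 0) F"
  show "\<forall>e::real. e > 0 \<longrightarrow> eventually (\<lambda>x. f x \<le> ennreal e) F"
  proof (intro allI impI)
    fix e :: real assume "e > 0"
    then show "eventually (\<lambda>x. f x \<le> ennreal e) F"
      using order_tendstoD(2)[OF f, of "ennreal e"] by (auto elim: eventually_mono)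
  qed
next
  assume a: "\<forall>e::real. e > 0 \<longrightarrow> eventually (\<lambda>x. f x \<le> ennreal e) F"
  show "(f \<longlongrightarrow> 0) F"
  proof (rule order_tendstoI)
    fix z :: ennreal assume "0 < z"
    then obtain w where w: "0 < w" "w < z" using dense by blast
    then obtain e where e: "w = ennreal e" "e > 0"
      by (metis ennreal_cases ennreal_less_zero_iff not_less top_greatest)
    then show "eventually (\<lambda>x. f x < z) F"
      using a w by (auto elim!: eventually_mono[OF spec[OF a, THEN mp]])
  qed auto
qed

lemma emet_Cauchy_real:
  assumes "emet_Cauchy X \<sigma>" and "e > (0::real)"
  shows "\<exists>N. \<forall>m\<ge>N. \<forall>n\<ge>N. edist X (\<sigma> m) (\<sigma> n) < ennreal e"
  using assms unfolding emet_Cauchy_def by (metis ennreal_less_zero_iff)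


section \<open>Path distances by non-expansive curves\<close>

text \<open>Curves of length at most \<open>L\<close>, up to reparametrisation, are the non-expansive maps on the interval
  \<open>[0, L]\<close>. A single inequality then expresses both continuity and the bound on the length, and
  it passes directly to concatenations, reversals and restrictions.\<close>

definition lip_curve :: "'a emet \<Rightarrow> real \<Rightarrow> (real \<Rightarrow> 'a) \<Rightarrow> bool" where
  "lip_curve X L g \<longleftrightarrow> 0 \<le> L \<and> g ` {0..L} \<subseteq> Pts X \<and>
     (\<forall>s t. 0 \<le> s \<longrightarrow> s \<le> t \<longrightarrow> t \<le> L \<longrightarrow> edist X (g s) (g t) \<le> ennreal (t - s))"

definition lip_joined :: "'a emet \<Rightarrow> real \<Rightarrow> 'a \<Rightarrow> 'a \<Rightarrow> bool" where
  "lip_joined X L x y \<longleftrightarrow> (\<exists>g. lip_curve X L g \<and> g 0 = x \<and> g L = y)"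

lemma lip_curveI:
  assumes "0 \<le> L" "\<And>t. 0 \<le> t \<Longrightarrow> t \<le> L \<Longrightarrow> g t \<in> Pts X"
    "\<And>s t. 0 \<le> s \<Longrightarrow> s \<le> t \<Longrightarrow> t \<le> L \<Longrightarrow> edist X (g s) (g t) \<le> ennreal (t - s)"
  shows "lip_curve X L g"
  using assms by (auto simp: lip_curve_def)

lemma lip_curveD:
  assumes "lip_curve X L g"
  shows "0 \<le> L" "\<And>t. 0 \<le> t \<Longrightarrow> t \<le> L \<Longrightarrow> g t \<in> Pts X"
    "\<And>s t. 0 \<le> s \<Longrightarrow> s \<le> t \<Longrightarrow> t \<le> L \<Longrightarrow> edist X (g s) (g t) \<le> ennreal (t - s)"
  using assms by (auto simp: lip_curve_def)

lemma lip_joined_Pts: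
  assumes "lip_joined X L x y"
  shows "x \<in> Pts X \<and> y \<in> Pts X \<and> 0 \<le> L"
proof -
  obtain g where g: "lip_curve X L g" "g 0 = x" "g L = y"
    using assms by (auto simp: lip_joined_def)
  show ?thesis
    using lip_curveD(1)[OF g(1)] lip_curveD(2)[OF g(1), of 0] lip_curveD(2)[OF g(1), of L] g(2,3) by simp
qed

lemma lip_joined_edist:
  assumes "lip_joined X L x y"
  shows "edist X x y \<le> ennreal L"
proof -
  obtain g where g: "lip_curve X L g" "g 0 = x" "g L = y"
    using assms by (auto simp: lip_joined_def)
  show ?thesis
    using lip_curveD(1)[OF g(1)] lip_curveD(3)[OF g(1), of 0 L] g(2,3) by simp
qed

lemma lip_joined_same: "is_emet X \<Longrightarrow> x \<in> Pts X \<Longrightarrow> 0 \<le> L \<Longrightarrow> lip_joined X L x x"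
  unfolding lip_joined_def by (intro exI[of _ "\<lambda>_. x"]) (auto intro: lip_curveI)

lemma lip_joined_restrict:
  assumes "lip_curve X L g" "0 \<le> s" "s \<le> t" "t \<le> L"
  shows "lip_joined X (t - s) (g s) (g t)"
proof -
  have "edist X (g (s + p)) (g (s + q)) \<le> ennreal (q - p)" if "0 \<le> p" "p \<le> q" "q \<le> t - s" for p q
    using lip_curveD(3)[OF assms(1), of "s + p" "s + q"] that assms by simp
  then have "lip_curve X (t - s) (\<lambda>r. g (s + r))"
    using assms lip_curveD[OF assms(1)] by (intro lip_curveI) auto
  then show ?thesis unfolding lip_joined_def by (intro exI[of _ "\<lambda>r. g (s + r)"]) auto
qed

lemma lip_joined_sym:
  assumes "is_emet X" "lip_joined X L x y"
  shows "lip_joined X L y x"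
proof -
  obtain g where g: "lip_curve X L g" "g 0 = x" "g L = y"
    using assms(2) by (auto simp: lip_joined_def)
  have "edist X (g (L - s)) (g (L - t)) \<le> ennreal (t - s)" if "0 \<le> s" "s \<le> t" "t \<le> L" for s t
    using lip_curveD(3)[OF g(1), of "L - t" "L - s"] that emet_sym[OF assms(1)] by simp
  then have "lip_curve X L (\<lambda>t. g (L - t))"
    using lip_curveD[OF g(1)] by (intro lip_curveI) auto
  then show ?thesis unfolding lip_joined_def using g by (intro exI[of _ "\<lambda>t. g (L - t)"]) auto
qed

lemma lip_curve_concat:
  assumes X: "is_emet X" and g: "lip_curve X L g" and h: "lip_curve X M h" and gh: "g L = h 0"
  shows "lip_curve X (L + M) (\<lambda>t. if t \<le> L then g t else h (t - L))"
proof (rule lip_curveI)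
  note gD = lip_curveD[OF g] and hD = lip_curveD[OF h]
  show "0 \<le> L + M" using gD hD by simp
  show "(if t \<le> L then g t else h (t - L)) \<in> Pts X" if "0 \<le> t" "t \<le> L + M" for t
    using that gD(2)[of t] hD(2)[of "t - L"] by simp
  fix s t assume st: "0 \<le> s" "s \<le> t" "t \<le> L + M"
  show "edist X (if s \<le> L then g s else h (s - L)) (if t \<le> L then g t else h (t - L)) \<le> ennreal (t - s)"
  proof (cases "s \<le> L \<and> L < t")
    case True
    have "edist X (g s) (h (t - L)) \<le> edist X (g s) (g L) + edist X (h 0) (h (t - L))"
      using emet_triangle[OF X, of "g s" "g L" "h (t - L)"] gD(1) gD(2)[of s] gD(2)[of L]
        hD(2)[of "t - L"] st True gh by simp
    also have "\<dots> \<le> ennreal (L - s) + ennreal (t - L - 0)"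
      using gD(3)[of s L] hD(3)[of 0 "t - L"] st True by (intro add_mono) auto
    also have "\<dots> = ennreal (t - s)"
      using True by (simp flip: ennreal_plus)
    finally show ?thesis using True by simp
  next
    case False
    then show ?thesis
      using gD(3)[of s t] hD(3)[of "s - L" "t - L"] st by auto
  qed
qed

lemma lip_joined_trans:
  assumes X: "is_emet X" and "lip_joined X L x y" and "lip_joined X M y z"
  shows "lip_joined X (L + M) x z"
proof -
  obtain g h where g: "lip_curve X L g" "g 0 = x" "g L = y" and h: "lip_curve X M h" "h 0 = y" "h M = z"
    using assms by (auto simp: lip_joined_def)
  have LM: "0 \<le> L" "0 \<le> M" using g h by (auto simp: lip_curve_def)
  show ?thesis
    unfolding lip_joined_def
    using lip_curve_concat[OF X g(1) h(1)] g h LM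
    by (intro exI[of _ "\<lambda>t. if t \<le> L then g t else h (t - L)"]) auto
qed

lemma lip_joined_image:
  assumes "lip_joined X L x y" "f ` Pts X \<subseteq> Pts Y"
    and "\<And>x y. x \<in> Pts X \<Longrightarrow> y \<in> Pts X \<Longrightarrow> edist Y (f x) (f y) \<le> edist X x y"
  shows "lip_joined Y L (f x) (f y)"
proof -
  obtain g where g: "lip_curve X L g" "g 0 = x" "g L = y"
    using assms(1) by (auto simp: lip_joined_def)
  note gD = lip_curveD[OF g(1)]
  have "edist Y (f (g s)) (f (g t)) \<le> ennreal (t - s)" if "0 \<le> s" "s \<le> t" "t \<le> L" for s t
    using order_trans[OF assms(3) gD(3)[OF that]] gD(2)[of s] gD(2)[of t] that by simp
  then have "lip_curve Y L (\<lambda>t. f (g t))"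
    using gD assms(2) by (intro lip_curveI) auto
  then show ?thesis unfolding lip_joined_def using g by (intro exI[of _ "\<lambda>t. f (g t)"]) auto
qed

lemma subdivision_mono:
  fixes t :: "nat \<Rightarrow> real"
  assumes "\<forall>i<n. t i \<le> t (Suc i)" "i \<le> j" "j \<le> n"
  shows "t i \<le> t j"
  using assms(2,3)
proof (induction j rule: dec_induct)
  case (step j)
  then have "t i \<le> t j" "t j \<le> t (Suc j)" using assms(1) by auto
  then show ?case by (rule order_trans)
qed simp

text \<open>For a non-expansive map on \<open>[0, L]\<close>, the sums that define the length are bounded by telescoping
  sums.\<close>

lemma path_dist_le:
  assumes X: "is_emet X" and "lip_joined X L x y"
  shows "path_dist X x y \<le> ennreal L"
proof -
  obtain g where g: "lip_curve X L g" "g 0 = x" "g L = y"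
    using assms(2) by (auto simp: lip_joined_def)
  note gD = lip_curveD[OF g(1)]
  have "is_curve X 0 L g"
    unfolding is_curve_def
  proof (intro conjI ballI)
    show "0 \<le> L" by (fact gD)
    show "g ` {0..L} \<subseteq> Pts X" using gD by auto
    fix t assume t: "t \<in> {0..L}"
    have le: "edist X (g s) (g t) \<le> ennreal \<bar>s - t\<bar>" if "s \<in> {0..L}" for s
      using gD(3)[of s t] gD(3)[of t s] that t emet_sym[OF X, of "g s" "g t"]
      by (cases "s \<le> t") (auto simp: abs_if)
    have "((\<lambda>s. ennreal \<bar>s - t\<bar>) \<longlongrightarrow> ennreal \<bar>t - t\<bar>) (at t within {0..L})"
      by (intro tendsto_intros)
    then have lim: "((\<lambda>s. ennreal \<bar>s - t\<bar>) \<longlongrightarrow> 0) (at t within {0..L})" by simp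
    have "eventually (\<lambda>s. edist X (g s) (g t) \<le> ennreal \<bar>s - t\<bar>) (at t within {0..L})"
      using le by (simp add: eventually_at_filter)
    then show "((\<lambda>s. edist X (g s) (g t)) \<longlongrightarrow> 0) (at t within {0..L})"
      by (rule tendsto_sandwich[OF _ _ tendsto_const lim, rotated]) simp
  qed
  then have "path_dist X x y \<le> curve_length X 0 L g"
    unfolding path_dist_def using g(2,3) by (intro Inf_lower) blast
  also have "\<dots> \<le> ennreal L"
    unfolding curve_length_def
  proof (rule Sup_least, safe)
    fix n and t :: "nat \<Rightarrow> real"
    assume t: "t 0 = 0" "L = t n" "\<forall>i<n. t i \<le> t (Suc i)"
    have "(\<Sum>i<n. edist X (g (t i)) (g (t (Suc i)))) \<le> (\<Sum>i<n. ennreal (t (Suc i) - t i))"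
    proof (rule sum_mono)
      fix i assume "i \<in> {..<n}"
      then show "edist X (g (t i)) (g (t (Suc i))) \<le> ennreal (t (Suc i) - t i)"
        using subdivision_mono[OF t(3), of 0 i] subdivision_mono[OF t(3), of "Suc i" n] t
        by (intro gD(3)) auto
    qed
    also have "\<dots> = ennreal (\<Sum>i<n. t (Suc i) - t i)"
      using t by (intro sum_ennreal) auto
    finally show "(\<Sum>i<n. edist X (g (t i)) (g (t (Suc i)))) \<le> ennreal (t n)"
      using t by (simp add: sum_lessThan_telescope)
  qed
  finally show ?thesis .
qed

lemma curve_length_append:
  assumes "a \<le> s" "s \<le> t"
  shows "curve_length X a s f + edist X (f s) (f t) \<le> curve_length X a t f"
proof -
  define A where "A = {\<Sum>i<n. edist X (f (p i)) (f (p (Suc i))) | n p.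
            p 0 = a \<and> p n = s \<and> (\<forall>i<n. p i \<le> p (Suc i))}"
  have "edist X (f a) (f s) \<in> A"
    unfolding A_def mem_Collect_eq
    using \<open>a \<le> s\<close> by (intro exI[of _ 1] exI[of _ "\<lambda>i. if i = 0 then a else s"]) simp
  then have "A \<noteq> {}" by blast
  have "curve_length X a s f + edist X (f s) (f t) = (SUP z\<in>A. z + edist X (f s) (f t))"
    using ennreal_SUP_add_left[OF \<open>A \<noteq> {}\<close>, where f = "\<lambda>z. z" and c = "edist X (f s) (f t)"]
    by (simp add: curve_length_def A_def)
  also have "\<dots> \<le> curve_length X a t f"
  proof (rule SUP_least)
    fix z assume "z \<in> A"
    then obtain n p where z: "z = (\<Sum>i<n. edist X (f (p i)) (f (p (Suc i))))"
      and p: "p 0 = a" "p n = s" "\<forall>i<n. p i \<le> p (Suc i)"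
      unfolding A_def by auto
    define q where "q i = (if i \<le> n then p i else t)" for i
    have "z + edist X (f s) (f t) = (\<Sum>i<Suc n. edist X (f (q i)) (f (q (Suc i))))"
      using p by (simp add: z q_def)
    moreover have "q 0 = a" "q (Suc n) = t" "\<forall>i<Suc n. q i \<le> q (Suc i)"
      using p \<open>s \<le> t\<close> by (auto simp: q_def less_Suc_eq)
    ultimately show "z + edist X (f s) (f t) \<le> curve_length X a t f"
      unfolding curve_length_def by (intro Sup_upper CollectI exI[of _ "Suc n"] exI[of _ q] conjI)
  qed
  finally show ?thesis .
qed

text \<open>
  Reparametrisation by arc length. Let \<open>v t\<close> be the length of \<open>f\<close> up to time \<open>t\<close>, and follow \<open>f\<close> at the
  times \<open>\<tau> r = sup {t. v t < r}\<close> for \<open>r \<in> [0, L]\<close>. The new curve is non-expansive: for \<open>r \<le> r'\<close>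
  and times \<open>u \<le> u'\<close> strictly between \<open>\<tau> r\<close> and \<open>\<tau> r'\<close> one has \<open>r \<le> v u\<close> and \<open>v u' \<le> r'\<close>, so the distance
  of \<open>f u\<close> and \<open>f u'\<close> is at most \<open>r' - r\<close>; now let \<open>u\<close> and \<open>u'\<close> tend to \<open>\<tau> r\<close> and \<open>\<tau> r'\<close>, using the
  continuity of \<open>f\<close>.
\<close>

lemma lip_joined_of_short_curve:
  assumes X: "is_emet X" and f: "is_curve X a b f" and len: "curve_length X a b f < ennreal L"
  shows "lip_joined X L (f a) (f b)"
proof -
  have ab: "a \<le> b" and fP: "\<And>t. t \<in> {a..b} \<Longrightarrow> f t \<in> Pts X"
    and cont: "\<And>t. t \<in> {a..b} \<Longrightarrow> ((\<lambda>s. edist X (f s) (f t)) \<longlongrightarrow> 0) (at t within {a..b})"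
    using f by (auto simp: is_curve_def)
  define v where "v t = enn2real (curve_length X a t f)" for t
  have fin: "curve_length X a t f < top" if "t \<in> {a..b}" for t
  proof -
    have "curve_length X a t f \<le> curve_length X a t f + edist X (f t) (f b)" by simp
    also have "\<dots> \<le> curve_length X a b f" using that by (intro curve_length_append) auto
    finally show ?thesis using len by (meson ennreal_less_top order_le_less_trans less_trans)
  qed
  have ev: "curve_length X a t f = ennreal (v t)" if "t \<in> {a..b}" for t
    using fin[OF that] by (simp add: v_def)
  have v0: "0 \<le> v t" for t by (simp add: v_def)
  have step: "v s \<le> v t \<and> edist X (f s) (f t) \<le> ennreal (v t - v s)" if "a \<le> s" "s \<le> t" "t \<le> b" for s t
  proof -
    have le: "ennreal (v s) + edist X (f s) (f t) \<le> ennreal (v t)"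
      using curve_length_append[of a s t X f] ev[of s] ev[of t] that by simp
    have "edist X (f s) (f t) \<le> ennreal (v t)"
      by (rule order_trans[OF _ le]) simp
    then obtain d where d: "edist X (f s) (f t) = ennreal d" "0 \<le> d"
      by (cases "edist X (f s) (f t)" rule: ennreal_cases) (auto simp: top_unique)
    have "v s + d \<le> v t" using le d v0[of s] v0[of t] by (simp flip: ennreal_plus)
    then show ?thesis using d by (auto intro: ennreal_leI)
  qed
  have vL: "v b < L" using len ev[of b] ab v0[of b] by (simp add: ennreal_less_iff)
  have near: "\<exists>\<delta>>0. \<forall>u \<in> {a..b}. \<bar>u - t\<bar> < \<delta> \<longrightarrow> edist X (f u) (f t) \<le> ennreal e"
    if t: "t \<in> {a..b}" and e: "e > 0" for t e
  proof -
    have "eventually (\<lambda>u. edist X (f u) (f t) \<le> ennreal e) (at t within {a..b})"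
      using cont[OF t] e by (simp add: tendsto_0_ennreal_iff)
    then obtain \<delta> where "\<delta> > 0" "\<forall>u \<in> {a..b}. u \<noteq> t \<and> dist u t < \<delta> \<longrightarrow> edist X (f u) (f t) \<le> ennreal e"
      by (auto simp: eventually_at)
    then show ?thesis
      using X by (intro exI[of _ \<delta>]) (auto simp: dist_real_def)
  qed
  \<comment> \<open>Including \<open>a\<close> makes the supremum meaningful at \<open>r = 0\<close>. The strict inequality gives \<open>\<tau> 0 = a\<close>,
    while \<open>v b < L\<close> gives \<open>\<tau> L = b\<close>, so that the new curve has the right end points.\<close>
  define E where "E r = {t \<in> {a..b}. t = a \<or> v t < r}" for r
  define \<tau> where "\<tau> r = Sup (E r)" for r
  have E: "a \<in> E r" "bdd_above (E r)" for r
    using ab by (auto simp: E_def intro: bdd_above_mono[of "{a..b}"])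
  have \<tau>: "\<tau> r \<in> {a..b}" for r
  proof -
    have "\<tau> r \<le> b"
      unfolding \<tau>_def using E(1)[of r] by (intro cSup_least) (auto simp: E_def)
    moreover have "a \<le> \<tau> r"
      unfolding \<tau>_def by (rule cSup_upper[OF E])
    ultimately show ?thesis by simp
  qed
  have lip: "edist X (f (\<tau> r)) (f (\<tau> r')) \<le> ennreal (r' - r)" if r: "r \<le> r'" for r r'
  proof -
    have "E r \<subseteq> E r'" using r by (auto simp: E_def)
    then have mono: "\<tau> r \<le> \<tau> r'"
      unfolding \<tau>_def using E(1)[of r] E(2)[of r'] by (intro cSup_subset_mono) auto
    show ?thesis
    proof (cases "\<tau> r = \<tau> r'")
      case True
      then show ?thesis using X by simp
    next
      case False
      with mono have less: "\<tau> r < \<tau> r'" by simp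
      show ?thesis
      proof (rule ennreal_le_epsilon)
        fix e :: real assume e: "0 < e"
        obtain \<delta> where \<delta>: "\<delta> > 0" "\<forall>u \<in> {a..b}. \<bar>u - \<tau> r\<bar> < \<delta> \<longrightarrow> edist X (f u) (f (\<tau> r)) \<le> ennreal (e/2)"
          using near[OF \<tau>, of "e/2" r] e by auto
        obtain \<delta>' where \<delta>': "\<delta>' > 0" "\<forall>u \<in> {a..b}. \<bar>u - \<tau> r'\<bar> < \<delta>' \<longrightarrow> edist X (f u) (f (\<tau> r')) \<le> ennreal (e/2)"
          using near[OF \<tau>, of "e/2" r'] e by auto
        define m where "m = min (min \<delta> \<delta>') (\<tau> r' - \<tau> r) / 3"
        define u u' where "u = \<tau> r + m" and "u' = \<tau> r' - m"
        have m: "m > 0" "m < \<delta>" "m < \<delta>'" "3 * m \<le> \<tau> r' - \<tau> r"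
          using \<delta>(1) \<delta>'(1) less by (auto simp: m_def min_def)
        have uu: "\<tau> r < u" "u \<le> u'" "u' < \<tau> r'" using m by (auto simp: u_def u'_def)
        then have u: "u \<in> {a..b}" "u' \<in> {a..b}" using \<tau>[of r] \<tau>[of r'] by auto
        have "r \<le> v u"
        proof (rule ccontr)
          assume "\<not> r \<le> v u"
          then have "u \<in> E r" using u by (simp add: E_def)
          then have "u \<le> \<tau> r" unfolding \<tau>_def by (rule cSup_upper[OF _ E(2)])
          then show False using uu(1) by simp
        qed
        moreover obtain t where t: "t \<in> E r'" "u' < t"
          using less_cSupE[of u' "E r'"] uu(3) E(1)[of r'] unfolding \<tau>_def by blast
        then have "v u' \<le> r'"
          using step[of u' t] u by (auto simp: E_def)
        ultimately have "edist X (f u) (f u') \<le> ennreal (r' - r)"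
          using step[of u u'] uu u by (meson atLeastAtMost_iff diff_mono ennreal_leI order_trans)
        moreover have "edist X (f (\<tau> r)) (f (\<tau> r')) \<le>
            edist X (f (\<tau> r)) (f u) + (edist X (f u) (f u') + edist X (f u') (f (\<tau> r')))"
          using emet_triangle[OF X fP[OF \<tau>[of r]] fP[OF u(1)] fP[OF \<tau>[of r']]]
            emet_triangle[OF X fP[OF u(1)] fP[OF u(2)] fP[OF \<tau>[of r']]]
          by (meson add_left_mono order_trans)
        moreover have "edist X (f (\<tau> r)) (f u) \<le> ennreal (e/2)"
          using \<delta>(2) u m by (subst emet_sym[OF X]) (simp add: u_def)
        moreover have "edist X (f u') (f (\<tau> r')) \<le> ennreal (e/2)"
          using \<delta>'(2) u m by (simp add: u'_def)
        ultimately have "edist X (f (\<tau> r)) (f (\<tau> r')) \<le> ennreal (e/2) + (ennreal (r' - r) + ennreal (e/2))"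
          by (meson add_mono order_trans)
        also have "\<dots> = ennreal (r' - r) + ennreal e"
          using e r by (simp flip: ennreal_plus)
        finally show "edist X (f (\<tau> r)) (f (\<tau> r')) \<le> ennreal (r' - r) + ennreal e" .
      qed
    qed
  qed
  have "E 0 = {a}" using v0 ab by (auto simp: E_def simp flip: not_le)
  then have \<tau>0: "\<tau> 0 = a" by (simp add: \<tau>_def)
  have "b \<in> E L" using vL ab by (simp add: E_def)
  then have "b \<le> \<tau> L" unfolding \<tau>_def by (rule cSup_upper[OF _ E(2)])
  then have \<tau>L: "\<tau> L = b" using \<tau>[of L] by simp
  have "0 \<le> L" using vL v0[of b] by simp
  then have "lip_curve X L (\<lambda>r. f (\<tau> r))"
    using fP[OF \<tau>] lip by (intro lip_curveI) auto
  then show ?thesis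
    unfolding lip_joined_def using \<tau>0 \<tau>L by (intro exI[of _ "\<lambda>r. f (\<tau> r)"]) auto
qed

lemma lip_joined_of_path_dist_less:
  assumes "is_emet X" "path_dist X x y < ennreal L"
  shows "lip_joined X L x y"
proof -
  obtain a b f where "is_curve X a b f" "f a = x" "f b = y" "curve_length X a b f < ennreal L"
    using assms(2) unfolding path_dist_def Inf_less_iff by auto
  then show ?thesis using lip_joined_of_short_curve[OF assms(1)] by blast
qed

text \<open>Together with \<open>path_dist_le\<close>, this makes the path distance the infimum of the lengths of
  intervals that join the two points.\<close>

lemma le_path_dist:
  assumes "is_emet X" "\<And>L. lip_joined X L x y \<Longrightarrow> z \<le> ennreal L"
  shows "z \<le> path_dist X x y"
proof (rule ccontr)
  assume "\<not> z \<le> path_dist X x y"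
  then obtain w where w: "path_dist X x y < w" "w < z" using dense by (metis not_le)
  then obtain L where "w = ennreal L" by (metis ennreal_cases not_top_less)
  then show False using w assms lip_joined_of_path_dist_less[OF assms(1), of x y L] by (simp add: leD)
qed

lemma edist_le_path_dist: "is_emet X \<Longrightarrow> edist X x y \<le> path_dist X x y"
  by (rule le_path_dist) (auto intro: lip_joined_edist)

lemma path_dist_same: "is_emet X \<Longrightarrow> x \<in> Pts X \<Longrightarrow> path_dist X x x = 0"
  using path_dist_le[OF _ lip_joined_same, of X x 0] by simp

lemma path_dist_sym: "is_emet X \<Longrightarrow> path_dist X x y = path_dist X y x"
  by (intro antisym; rule le_path_dist) (auto intro: path_dist_le lip_joined_sym)

lemma path_dist_triangle:
  assumes X: "is_emet X"
  shows "path_dist X x z \<le> path_dist X x y + path_dist X y z"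
proof (rule ennreal_le_epsilon)
  fix e :: real assume fin: "path_dist X x y + path_dist X y z < top" and e: "0 < e"
  have near: "\<exists>L. lip_joined X L x y \<and> ennreal L = path_dist X x y + ennreal (e/2)"
    if xy: "path_dist X x y \<noteq> top" for x y
  proof -
    obtain p where p: "path_dist X x y = ennreal p" "0 \<le> p" 
      using xy by (cases "path_dist X x y" rule: ennreal_cases) auto
    then show ?thesis
      using e lip_joined_of_path_dist_less[OF X, of x y "p + e/2"]
      by (intro exI[of _ "p + e/2"]) (auto simp: ennreal_less_iff)
  qed
  obtain L where L: "lip_joined X L x y" "ennreal L = path_dist X x y + ennreal (e/2)"
    using near[of x y] fin by (auto simp: less_top)
  obtain M where M: "lip_joined X M y z" "ennreal M = path_dist X y z + ennreal (e/2)"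
    using near[of y z] fin by (auto simp: less_top)
  have "path_dist X x z \<le> ennreal (L + M)"
    using path_dist_le[OF X lip_joined_trans[OF X L(1) M(1)]] .
  also have "\<dots> = ennreal L + ennreal M"
    using lip_joined_Pts[OF L(1)] lip_joined_Pts[OF M(1)] by simp
  also have "\<dots> = path_dist X x y + path_dist X y z + (ennreal (e/2) + ennreal (e/2))"
    unfolding L(2) M(2) by (simp only: ac_simps)
  also have "ennreal (e/2) + ennreal (e/2) = ennreal e" using e by (simp flip: ennreal_plus)
  finally show "path_dist X x z \<le> path_dist X x y + path_dist X y z + ennreal e" .
qed

lemma path_dist_image:
  assumes "is_emet X" "is_emet Y" "f ` Pts X \<subseteq> Pts Y"
    and "\<And>x y. x \<in> Pts X \<Longrightarrow> y \<in> Pts X \<Longrightarrow> edist Y (f x) (f y) \<le> edist X x y"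
  shows "path_dist Y (f x) (f y) \<le> path_dist X x y"
  using lip_joined_image[OF _ assms(3,4)] path_dist_le[OF assms(2)]
  by (intro le_path_dist[OF assms(1)]) blast


section \<open>The path space of a space\<close>

definition path_space :: "'a emet \<Rightarrow> 'a emet" where
  "path_space X = \<lparr>Pts = Pts X,
     edist = (\<lambda>x y. if x \<in> Pts X \<and> y \<in> Pts X then path_dist X x y else 0)\<rparr>"

lemma Pts_path_space [simp]: "Pts (path_space X) = Pts X"
  by (simp add: path_space_def)

lemma edist_path_space: "x \<in> Pts X \<Longrightarrow> y \<in> Pts X \<Longrightarrow> edist (path_space X) x y = path_dist X x y"
  by (simp add: path_space_def)

lemma is_emet_path_space:
  assumes X: "is_emet X"
  shows "is_emet (path_space X)"
proof -
  have "x = y" if "x \<in> Pts X" "y \<in> Pts X" "path_dist X x y = 0" for x y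
    using that edist_le_path_dist[OF X, of x y] emet_eq[OF X] by simp
  then show ?thesis
    unfolding is_emet_def
  proof (intro conjI ballI allI impI)
    fix x y assume "x \<in> Pts (path_space X)" "y \<in> Pts (path_space X)"
    then show "edist (path_space X) x y = edist (path_space X) y x"
      using path_dist_sym[OF X, of x y] by (simp add: edist_path_space)
  qed (use path_dist_same[OF X] path_dist_triangle[OF X] in \<open>auto simp: path_space_def\<close>)
qed

text \<open>The idempotence of path distances: the pieces of a non-expansive map on an interval bound the path
  distances of its values.\<close>

lemma lip_joined_path_space:
  assumes X: "is_emet X" and "lip_joined X L x y"
  shows "lip_joined (path_space X) L x y"
proof -
  obtain g where g: "lip_curve X L g" "g 0 = x" "g L = y"
    using assms(2) by (auto simp: lip_joined_def)
  have "lip_curve (path_space X) L g"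
    using lip_curveD[OF g(1)] path_dist_le[OF X lip_joined_restrict[OF g(1)]]
    by (intro lip_curveI) (auto simp: edist_path_space)
  then show ?thesis using g by (auto simp: lip_joined_def)
qed

lemma is_path_emet_path_space:
  assumes X: "is_emet X"
  shows "is_path_emet (path_space X)"
proof -
  note PX = is_emet_path_space[OF X]
  have "path_dist (path_space X) x y \<le> path_dist X x y" for x y
    using path_dist_le[OF PX lip_joined_path_space[OF X]] by (rule le_path_dist[OF X])
  then show ?thesis
    unfolding is_path_emet_def using PX edist_le_path_dist[OF PX]
    by (auto simp: edist_path_space intro!: antisym) (metis edist_path_space)
qed

text \<open>
  Concatenation of infinitely many intervals of lengths \<open>c, c/2, c/4, \<dots>\<close>. The resulting map on
  \<open>[0, 2 * c)\<close> is non-expansive, and it stays so when it takes the value \<open>x\<close> at \<open>2 * c\<close>, because the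
  junction points converge to \<open>x\<close>.
\<close>

lemma lip_joined_limit:
  fixes y :: "nat \<Rightarrow> 'a"
  assumes X: "is_emet X" and c: "0 < c"
    and y: "\<And>k. lip_joined X (c * (1/2)^k) (y k) (y (Suc k))"
    and x: "x \<in> Pts X" and lim: "(\<lambda>k. edist X (y k) x) \<longlonglongrightarrow> 0"
  shows "lip_joined X (2 * c) (y 0) x"
proof -
  have yP: "y k \<in> Pts X" for k using lip_joined_Pts[OF y] by blast
  obtain h where h: "\<And>k. lip_curve X (c * (1/2)^k) (h k)" "\<And>k. h k 0 = y k"
      "\<And>k. h k (c * (1/2)^k) = y (Suc k)"
    using y unfolding lip_joined_def by metis
  \<comment> \<open>\<open>P k\<close> is the total length of the first \<open>k\<close> intervals, and \<open>G k\<close> their concatenation.\<close>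
  define P where "P k = c * (2 - 2 * (1/2)^k)" for k :: nat
  have P0: "P 0 = 0" and PS: "P (Suc k) = P k + c * (1/2)^k" and P2: "P k < 2 * c" for k
    using c by (auto simp: P_def field_simps)
  have Pmono: "P k \<le> P m" if "k \<le> m" for k m
    using that c by (auto simp: P_def power_decreasing)
  have P_lim: "P \<longlonglongrightarrow> c * (2 - 2 * 0)"
    unfolding P_def by (intro tendsto_intros LIMSEQ_power_zero) auto
  define G where "G = rec_nat (\<lambda>_. y 0) (\<lambda>k g t. if t \<le> P k then g t else h k (t - P k))"
  have G0: "G 0 = (\<lambda>_. y 0)" by (simp add: G_def)
  have GS: "G (Suc k) = (\<lambda>t. if t \<le> P k then G k t else h k (t - P k))" for k
    unfolding G_def by (simp only: nat.rec)
  have G: "lip_curve X (P k) (G k) \<and> G k 0 = y 0 \<and> G k (P k) = y k" for k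
  proof (induction k)
    case 0
    show ?case using X yP by (auto simp: P0 G0 intro: lip_curveI)
  next
    case (Suc k)
    have "0 < c * (1/2)^k" using c by simp
    moreover have "0 \<le> P k" using Suc by (simp add: lip_curve_def)
    ultimately show ?case
      using Suc lip_curve_concat[OF X _ h(1)[of k], of "P k" "G k"] h(2,3)[of k]
      by (auto simp: PS GS)
  qed
  have G_stable: "G m t = G k t" if "k \<le> m" "t \<le> P k" for k m t
    using that(1)
  proof (induction m rule: dec_induct)
    case (step m)
    then show ?case using that Pmono[of k m] by (simp add: GS)
  qed simp
  define g where "g t = (if t < 2 * c then G (LEAST k. t \<le> P k) t else x)" for t
  have gG: "g t = G k t" if "t \<le> P k" for t k
    using that P2[of k] G_stable[OF Least_le[of "\<lambda>k. t \<le> P k" k] LeastI[of "\<lambda>k. t \<le> P k" k]]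
    by (simp add: g_def)
  have late: "eventually (\<lambda>k. t \<le> P k) sequentially" if "t < 2 * c" for t
    using order_tendstoD(1)[OF P_lim, of t] that by (auto elim: eventually_mono)
  have early: "\<exists>k. t \<le> P k" if "t < 2 * c" for t
    using late[OF that] by (auto simp: eventually_sequentially)
  have gP: "g t \<in> Pts X" if "0 \<le> t" for t
  proof (cases "t < 2 * c")
    case True
    then obtain k where "t \<le> P k" using early by blast
    then show ?thesis using gG[of t k] lip_curveD(2)[of X "P k" "G k"] G that by auto
  qed (use x in \<open>simp add: g_def\<close>)
  have "lip_curve X (2 * c) g"
  proof (rule lip_curveI)
    show "0 \<le> 2 * c" using c by simp
    show "g t \<in> Pts X" if "0 \<le> t" for t by (fact gP[OF that])
    fix s t assume st: "0 \<le> s" "s \<le> t" "t \<le> 2 * c"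
    consider "t < 2 * c" | "s < 2 * c" "t = 2 * c" | "s = 2 * c" "t = 2 * c"
      using st by linarith
    then show "edist X (g s) (g t) \<le> ennreal (t - s)"
    proof cases
      case 1
      then obtain k where "t \<le> P k" using early by blast
      then show ?thesis using gG[of s k] gG[of t k] G[of k] st lip_curveD(3)[of X "P k" "G k" s t] by auto
    next
      case 2
      show ?thesis
      proof (rule ennreal_le_epsilon)
        fix e :: real assume "0 < e"
        then have "eventually (\<lambda>k. edist X (y k) x \<le> ennreal e) sequentially"
          using lim by (simp add: tendsto_0_ennreal_iff)
        from eventually_happens'[OF _ eventually_conj[OF this late[OF 2(1)]]]
        obtain k where k: "edist X (y k) x \<le> ennreal e" "s \<le> P k" by auto
        have "edist X (g s) x \<le> edist X (g s) (y k) + edist X (y k) x"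
          using emet_triangle[OF X gP yP x] st by blast
        moreover have "edist X (g s) (y k) \<le> ennreal (P k - s)"
          using gG[OF k(2)] G[of k] lip_curveD(3)[of X "P k" "G k" s "P k"] st k(2) by auto
        moreover have "ennreal (P k - s) \<le> ennreal (t - s)"
          using P2[of k] 2 by (intro ennreal_leI) simp
        moreover have "g t = x" using 2 by (simp add: g_def)
        ultimately show "edist X (g s) (g t) \<le> ennreal (t - s) + ennreal e"
          using k(1) by (auto intro: order_trans[OF _ add_mono] order_trans)
      qed
    next
      case 3
      then show ?thesis using X by simp
    qed
  qed
  moreover have "g 0 = y 0" using gG[of 0 0] by (simp add: P0 G0)
  moreover have "g (2 * c) = x" by (simp add: g_def)
  ultimately show ?thesis unfolding lip_joined_def by blast
qed

text \<open>A Cauchy sequence for the path distance converges in \<open>X\<close>, since distances are bounded by path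
  distances. Joining the terms of a fast subsequence, the preceding lemma bounds the path distance to
  the limit as well.\<close>

lemma emet_complete_path_space:
  assumes X: "is_emet X" and complete: "emet_complete X"
  shows "emet_complete (path_space X)"
  unfolding emet_complete_def
proof (intro allI impI)
  fix \<sigma> assume \<sigma>: "emet_Cauchy (path_space X) \<sigma>"
  then have \<sigma>P: "\<sigma> n \<in> Pts X" for n by (auto simp: emet_Cauchy_def)
  have "emet_Cauchy X \<sigma>"
    using \<sigma> edist_le_path_dist[OF X] unfolding emet_Cauchy_def
    by (auto simp: edist_path_space[OF \<sigma>P \<sigma>P]) (meson order_le_less_trans)
  then obtain x where x: "x \<in> Pts X" "(\<lambda>n. edist X (\<sigma> n) x) \<longlonglongrightarrow> 0"
    using complete by (auto simp: emet_complete_def)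
  have "\<exists>N. \<forall>m\<ge>N. \<forall>n\<ge>N. path_dist X (\<sigma> m) (\<sigma> n) < ennreal ((1/2)^k)" for k :: nat
    using emet_Cauchy_real[OF \<sigma>, of "(1/2)^k"] by (auto simp: edist_path_space[OF \<sigma>P \<sigma>P])
  then obtain N where N: "\<And>k m n. N k \<le> m \<Longrightarrow> N k \<le> n \<Longrightarrow> path_dist X (\<sigma> m) (\<sigma> n) < ennreal ((1/2)^k)"
    by metis
  define r where "r k = k + (\<Sum>i\<le>k. N i)" for k
  have rN: "N k \<le> r k" for k unfolding r_def by (simp add: member_le_sum trans_le_add2)
  have rS: "strict_mono r" by (rule strict_monoI_Suc) (simp add: r_def)
  have step: "lip_joined X ((1/2)^k) (\<sigma> m) (\<sigma> n)" if "r k \<le> m" "r k \<le> n" for k m n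
    using lip_joined_of_path_dist_less[OF X N] that rN[of k] by (meson order_trans)
  \<comment> \<open>One interval of length \<open>(1/2)^m\<close> leads from \<open>\<sigma> n\<close> to \<open>\<sigma> (r m)\<close>, and an infinite concatenation of
    total length \<open>2 * (1/2)^m\<close> from there to \<open>x\<close>.\<close>
  have tail: "path_dist X (\<sigma> n) x \<le> ennreal (3 * (1/2)^m)" if n: "r m \<le> n" for m n
  proof -
    have "lip_joined X ((1/2)^m * (1/2)^k) (\<sigma> (r (m + k))) (\<sigma> (r (m + Suc k)))" for k
      using step[of "m + k" "r (m + k)" "r (m + Suc k)"] rS
      by (simp add: power_add strict_mono_less_eq)
    moreover have "(\<lambda>k. edist X (\<sigma> (r (m + k))) x) \<longlonglongrightarrow> 0"
      using LIMSEQ_subseq_LIMSEQ[OF x(2), of "\<lambda>k. r (m + k)"] rS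
      by (simp add: comp_def strict_mono_def)
    ultimately have "lip_joined X (2 * (1/2)^m) (\<sigma> (r m)) x"
      using lip_joined_limit[OF X _ _ x(1), of "(1/2)^m" "\<lambda>k. \<sigma> (r (m + k))"] by simp
    from path_dist_le[OF X lip_joined_trans[OF X step[OF n order_refl] this]]
    show ?thesis by simp
  qed
  have "(\<lambda>n. path_dist X (\<sigma> n) x) \<longlonglongrightarrow> 0"
    unfolding tendsto_0_ennreal_iff
  proof (intro allI impI)
    fix e :: real assume e: "0 < e"
    obtain m where "(1/2)^m < e/3" using real_arch_pow_inv[of "e/3" "1/2"] e by auto
    then have "ennreal (3 * (1/2)^m) \<le> ennreal e" by (intro ennreal_leI) simp
    then show "eventually (\<lambda>n. path_dist X (\<sigma> n) x \<le> ennreal e) sequentially"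
      unfolding eventually_sequentially using tail order_trans by blast
  qed
  then show "\<exists>x \<in> Pts (path_space X). (\<lambda>n. edist (path_space X) (\<sigma> n) x) \<longlonglongrightarrow> 0"
    using x(1) \<sigma>P by (auto simp: edist_path_space)
qed


section \<open>Small sets\<close>

lemma small_image:
  "small U A \<Longrightarrow> small U (f ` A)"
  unfolding small_def using card_of_image ordLeq_ordLess_trans by blast

lemma small_UN:
  assumes "is_universe TYPE('u)" "small TYPE('u) I" "\<And>i. i \<in> I \<Longrightarrow> small TYPE('u) (A i)"
  shows "small TYPE('u) (\<Union>i\<in>I. A i)"
  unfolding small_def
proof (rule card_of_UNION_ordLess_infinite_Field_regularCard)
  show "regularCard |UNIV :: 'u set|" "Cinfinite |UNIV :: 'u set|"
    using assms(1) by (auto simp: is_universe_def cinfinite_def Field_card_of card_of_card_order_on)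
qed (use assms in \<open>auto simp: small_def\<close>)

lemma small_embeds:
  assumes "small TYPE('u) A"
  obtains e :: "'a \<Rightarrow> 'u" where "inj_on e A"
proof -
  have "|A| \<le>o |UNIV :: 'u set|" using assms by (simp add: small_def ordLess_imp_ordLeq)
  then obtain e :: "'a \<Rightarrow> 'u" where "inj_on e A \<and> e ` A \<subseteq> UNIV"
    unfolding card_of_ordLeq[symmetric] by blast
  then show thesis using that by blast
qed

text \<open>The closure of the universe under countable powers, transferred from subsets of \<open>'u\<close> to arbitrary
  small sets.\<close>

lemma small_sequences:
  fixes A :: "'a set"
  assumes "is_universe TYPE('u)" "small TYPE('u) A"
  shows "small TYPE('u) {s :: nat \<Rightarrow> 'a. range s \<subseteq> A}"
proof -
  obtain e :: "'a \<Rightarrow> 'u" where e: "inj_on e A" using small_embeds[OF assms(2)] .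
  have "small TYPE('u) {s :: nat \<Rightarrow> 'u. range s \<subseteq> e ` A}"
    using assms small_image by (auto simp: is_universe_def)
  then have "small TYPE('u) ((\<lambda>s. inv_into A e \<circ> s) ` {s :: nat \<Rightarrow> 'u. range s \<subseteq> e ` A})"
    by (rule small_image)
  moreover have "s \<in> (\<lambda>s. inv_into A e \<circ> s) ` {s :: nat \<Rightarrow> 'u. range s \<subseteq> e ` A}"
    if "range s \<subseteq> A" for s :: "nat \<Rightarrow> 'a"
  proof (rule image_eqI)
    show "s = inv_into A e \<circ> (e \<circ> s)"
      using that e by (auto simp: fun_eq_iff range_subsetD inv_into_f_f)
  qed (use that in auto)
  then have "{s :: nat \<Rightarrow> 'a. range s \<subseteq> A} \<subseteq> (\<lambda>s. inv_into A e \<circ> s) ` {s :: nat \<Rightarrow> 'u. range s \<subseteq> e ` A}"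
    by blast
  ultimately show ?thesis
    unfolding small_def using card_of_mono1 ordLeq_ordLess_trans by blast
qed


section \<open>Products, closures and pullbacks of spaces\<close>

definition sup_product :: "'i set \<Rightarrow> ('i \<Rightarrow> 'a emet) \<Rightarrow> ('i \<Rightarrow> 'a) emet" where
  "sup_product I X = \<lparr>Pts = (\<Pi>\<^sub>E i\<in>I. Pts (X i)),
     edist = (\<lambda>\<phi> \<psi>. if \<phi> \<in> (\<Pi>\<^sub>E i\<in>I. Pts (X i)) \<and> \<psi> \<in> (\<Pi>\<^sub>E i\<in>I. Pts (X i))
       then SUP i\<in>I. edist (X i) (\<phi> i) (\<psi> i) else 0)\<rparr>"

lemma Pts_sup_product [simp]: "Pts (sup_product I X) = (\<Pi>\<^sub>E i\<in>I. Pts (X i))"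
  by (simp add: sup_product_def)

lemma edist_sup_product:
  "\<phi> \<in> Pts (sup_product I X) \<Longrightarrow> \<psi> \<in> Pts (sup_product I X) \<Longrightarrow>
    edist (sup_product I X) \<phi> \<psi> = (SUP i\<in>I. edist (X i) (\<phi> i) (\<psi> i))"
  by (simp add: sup_product_def)

lemma edist_sup_product_upper:
  "\<phi> \<in> Pts (sup_product I X) \<Longrightarrow> \<psi> \<in> Pts (sup_product I X) \<Longrightarrow> i \<in> I \<Longrightarrow>
    edist (X i) (\<phi> i) (\<psi> i) \<le> edist (sup_product I X) \<phi> \<psi>"
  unfolding edist_sup_product by (rule SUP_upper)

lemma is_emet_sup_product:
  assumes X: "\<And>i. i \<in> I \<Longrightarrow> is_emet (X i)"
  shows "is_emet (sup_product I X)"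
  unfolding is_emet_def
proof (intro conjI ballI allI impI)
  let ?P = "sup_product I X"
  fix \<phi> \<psi> assume \<phi>: "\<phi> \<in> Pts ?P" and \<psi>: "\<psi> \<in> Pts ?P"
  show "edist ?P \<phi> \<psi> = 0 \<longleftrightarrow> \<phi> = \<psi>"
  proof
    assume 0: "edist ?P \<phi> \<psi> = 0"
    have "\<phi> i = \<psi> i" if i: "i \<in> I" for i
      using emet_eq[OF X[OF i], of "\<phi> i" "\<psi> i"] edist_sup_product_upper[OF \<phi> \<psi> i] 0 \<phi> \<psi> i by auto
    then show "\<phi> = \<psi>" using \<phi> \<psi> by (auto intro: PiE_ext)
  next
    assume "\<phi> = \<psi>"
    then have "edist ?P \<phi> \<psi> \<le> 0"
      unfolding edist_sup_product[OF \<phi> \<psi>] using X by (intro SUP_least) simp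
    then show "edist ?P \<phi> \<psi> = 0" by simp
  qed
  show "edist ?P \<phi> \<psi> = edist ?P \<psi> \<phi>"
    unfolding edist_sup_product[OF \<phi> \<psi>] edist_sup_product[OF \<psi> \<phi>]
    by (intro SUP_cong refl emet_sym X)
  fix \<theta> assume \<theta>: "\<theta> \<in> Pts ?P"
  show "edist ?P \<phi> \<theta> \<le> edist ?P \<phi> \<psi> + edist ?P \<psi> \<theta>"
    unfolding edist_sup_product[OF \<phi> \<theta>]
  proof (rule SUP_least)
    fix i assume i: "i \<in> I"
    have "edist (X i) (\<phi> i) (\<theta> i) \<le> edist (X i) (\<phi> i) (\<psi> i) + edist (X i) (\<psi> i) (\<theta> i)"
      using \<phi> \<psi> \<theta> i by (intro emet_triangle[OF X[OF i]]) auto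
    also have "\<dots> \<le> edist ?P \<phi> \<psi> + edist ?P \<psi> \<theta>"
      by (intro add_mono edist_sup_product_upper \<phi> \<psi> \<theta> i)
    finally show "edist (X i) (\<phi> i) (\<theta> i) \<le> edist ?P \<phi> \<psi> + edist ?P \<psi> \<theta>" .
  qed
qed (auto simp: sup_product_def)

lemma emet_complete_sup_product:
  assumes X: "\<And>i. i \<in> I \<Longrightarrow> is_emet (X i)" and complete: "\<And>i. i \<in> I \<Longrightarrow> emet_complete (X i)"
  shows "emet_complete (sup_product I X)"
  unfolding emet_complete_def
proof (intro allI impI)
  let ?P = "sup_product I X"
  fix \<sigma> assume \<sigma>: "emet_Cauchy ?P \<sigma>"
  then have \<sigma>P: "\<sigma> n \<in> Pts ?P" for n by (auto simp: emet_Cauchy_def)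
  have "emet_Cauchy (X i) (\<lambda>n. \<sigma> n i)" if i: "i \<in> I" for i
    unfolding emet_Cauchy_def
  proof (intro conjI allI impI)
    show "range (\<lambda>n. \<sigma> n i) \<subseteq> Pts (X i)" using \<sigma>P i by auto
    fix e :: ennreal assume "e > 0"
    then obtain N where "\<forall>m\<ge>N. \<forall>n\<ge>N. edist ?P (\<sigma> m) (\<sigma> n) < e"
      using \<sigma> unfolding emet_Cauchy_def by blast
    then show "\<exists>N. \<forall>m\<ge>N. \<forall>n\<ge>N. edist (X i) (\<sigma> m i) (\<sigma> n i) < e"
      using edist_sup_product_upper[OF \<sigma>P \<sigma>P i] order_le_less_trans by blast
  qed
  then have "\<forall>i\<in>I. \<exists>x. x \<in> Pts (X i) \<and> (\<lambda>n. edist (X i) (\<sigma> n i) x) \<longlonglongrightarrow> 0"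
    using complete unfolding emet_complete_def by blast
  then obtain l where l: "\<And>i. i \<in> I \<Longrightarrow> l i \<in> Pts (X i)"
      "\<And>i. i \<in> I \<Longrightarrow> (\<lambda>n. edist (X i) (\<sigma> n i) (l i)) \<longlonglongrightarrow> 0"
    by metis
  define \<phi> where "\<phi> = (\<lambda>i\<in>I. l i)"
  have \<phi>: "\<phi> \<in> Pts ?P" using l(1) by (simp add: \<phi>_def)
  have "(\<lambda>n. edist ?P (\<sigma> n) \<phi>) \<longlonglongrightarrow> 0"
    unfolding tendsto_0_ennreal_iff
  proof (intro allI impI)
    fix e :: real assume "0 < e"
    then obtain N where N: "\<forall>m\<ge>N. \<forall>n\<ge>N. edist ?P (\<sigma> m) (\<sigma> n) < ennreal e"
      using emet_Cauchy_real[OF \<sigma>] by blast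
    have "edist ?P (\<sigma> n) \<phi> \<le> ennreal e" if n: "n \<ge> N" for n
      unfolding edist_sup_product[OF \<sigma>P \<phi>]
    proof (rule SUP_least)
      fix i assume i: "i \<in> I"
      have "edist (X i) (\<sigma> n i) (l i) \<le> ennreal e"
      proof (rule ennreal_le_epsilon)
        fix d :: real assume "0 < d"
        then have "eventually (\<lambda>m. edist (X i) (\<sigma> m i) (l i) \<le> ennreal d) sequentially"
          using l(2)[OF i] unfolding tendsto_0_ennreal_iff by blast
        from eventually_happens'[OF _ eventually_conj[OF this eventually_ge_at_top[of N]]]
        obtain m where m: "edist (X i) (\<sigma> m i) (l i) \<le> ennreal d" "m \<ge> N" by auto
        have "edist (X i) (\<sigma> n i) (l i) \<le> edist (X i) (\<sigma> n i) (\<sigma> m i) + edist (X i) (\<sigma> m i) (l i)"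
          using \<sigma>P[of n] \<sigma>P[of m] i l(1)[OF i] by (intro emet_triangle[OF X[OF i]]) auto
        also have "\<dots> \<le> ennreal e + ennreal d"
          using order_trans[OF edist_sup_product_upper[OF \<sigma>P[of n] \<sigma>P[of m] i]] N n m
          by (intro add_mono) (auto intro: less_imp_le)
        finally show "edist (X i) (\<sigma> n i) (l i) \<le> ennreal e + ennreal d" .
      qed
      then show "edist (X i) (\<sigma> n i) (\<phi> i) \<le> ennreal e" using i by (simp add: \<phi>_def)
    qed
    then show "eventually (\<lambda>n. edist ?P (\<sigma> n) \<phi> \<le> ennreal e) sequentially"
      unfolding eventually_sequentially by blast
  qed
  then show "\<exists>\<phi> \<in> Pts ?P. (\<lambda>n. edist ?P (\<sigma> n) \<phi>) \<longlonglongrightarrow> 0"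
    using \<phi> by blast
qed

text \<open>Limits of sequences suffice for the closure in a metric space; describing it by sequences is what
  bounds its cardinality.\<close>

definition closure_in :: "'a emet \<Rightarrow> 'a set \<Rightarrow> 'a set" where
  "closure_in X A = {x \<in> Pts X. \<exists>s. range s \<subseteq> A \<and> (\<lambda>n. edist X (s n) x) \<longlonglongrightarrow> 0}"

lemma subset_closure_in: "is_emet X \<Longrightarrow> A \<subseteq> Pts X \<Longrightarrow> A \<subseteq> closure_in X A"
proof
  fix a assume "is_emet X" "A \<subseteq> Pts X" "a \<in> A"
  then show "a \<in> closure_in X A"
    unfolding closure_in_def by (auto intro!: exI[of _ "\<lambda>_. a"])
qed

lemma limit_unique:
  assumes X: "is_emet X" and s: "\<And>n. s n \<in> Pts X" and x: "x \<in> Pts X" and y: "y \<in> Pts X"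
    and lim: "(\<lambda>n. edist X (s n) x) \<longlonglongrightarrow> 0" "(\<lambda>n. edist X (s n) y) \<longlonglongrightarrow> 0"
  shows "x = y"
proof -
  have "(\<lambda>n. edist X (s n) x + edist X (s n) y) \<longlonglongrightarrow> 0 + 0"
    by (intro tendsto_add lim)
  moreover have "edist X x y \<le> edist X (s n) x + edist X (s n) y" for n
    using emet_triangle[OF X x s[of n] y] emet_sym[OF X, of x "s n"] by simp
  ultimately have "edist X x y \<le> 0 + 0"
    by (intro LIMSEQ_le_const) auto
  then show ?thesis using emet_eq[OF X x y] by simp
qed

text \<open>By uniqueness of limits, the closure is the image of a set of sequences in \<open>A\<close>.\<close>

lemma small_closure_in:
  fixes A :: "'a set"
  assumes U: "is_universe TYPE('u)" and X: "is_emet X" and A: "A \<subseteq> Pts X" "small TYPE('u) A"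
  shows "small TYPE('u) (closure_in X A)"
proof -
  define lim where "lim s = (THE x. x \<in> Pts X \<and> (\<lambda>n. edist X (s n) x) \<longlonglongrightarrow> 0)" for s :: "nat \<Rightarrow> 'a"
  have "x \<in> lim ` {s. range s \<subseteq> A}" if "x \<in> closure_in X A" for x
  proof -
    obtain s where s: "x \<in> Pts X" "range s \<subseteq> A" "(\<lambda>n. edist X (s n) x) \<longlonglongrightarrow> 0"
      using \<open>x \<in> closure_in X A\<close> by (auto simp: closure_in_def)
    then have "s n \<in> Pts X" for n using A by auto
    then have "lim s = x"
      unfolding lim_def using s limit_unique[OF X, of s] by (intro the_equality) auto
    then show ?thesis using s(2) by blast
  qed
  then have "closure_in X A \<subseteq> lim ` {s. range s \<subseteq> A}" by blast
  then show ?thesis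
    using small_image[OF small_sequences[OF U A(2)], of lim]
    unfolding small_def using card_of_mono1 ordLeq_ordLess_trans by blast
qed

text \<open>Approximate the \<open>n\<close>-th term of the sequence by a point of \<open>A\<close> up to \<open>(1/2)^n\<close>.\<close>

lemma closure_in_closed:
  assumes X: "is_emet X" and A: "A \<subseteq> Pts X" and s: "\<And>n. s n \<in> closure_in X A"
    and x: "x \<in> Pts X" and lim: "(\<lambda>n. edist X (s n) x) \<longlonglongrightarrow> 0"
  shows "x \<in> closure_in X A"
proof -
  have "\<exists>a\<in>A. edist X a (s n) \<le> ennreal ((1/2)^n)" for n
  proof -
    obtain r where r: "range r \<subseteq> A" "(\<lambda>m. edist X (r m) (s n)) \<longlonglongrightarrow> 0"
      using s[of n] by (auto simp: closure_in_def)
    then have "eventually (\<lambda>m. edist X (r m) (s n) \<le> ennreal ((1/2)^n)) sequentially"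
      unfolding tendsto_0_ennreal_iff by simp
    from eventually_happens'[OF _ this] obtain m where "edist X (r m) (s n) \<le> ennreal ((1/2)^n)"
      by auto
    then show ?thesis using r(1) by blast
  qed
  then obtain a where a: "\<And>n. a n \<in> A" "\<And>n. edist X (a n) (s n) \<le> ennreal ((1/2)^n)"
    by metis
  have "(\<lambda>n. ennreal ((1/2)^n) + edist X (s n) x) \<longlonglongrightarrow> ennreal 0 + 0"
    by (intro tendsto_add lim tendsto_ennrealI LIMSEQ_power_zero) simp
  then have 0: "(\<lambda>n. ennreal ((1/2)^n) + edist X (s n) x) \<longlonglongrightarrow> 0" by simp
  have "edist X (a n) x \<le> ennreal ((1/2)^n) + edist X (s n) x" for n
  proof -
    have "edist X (a n) x \<le> edist X (a n) (s n) + edist X (s n) x"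
      using a(1)[of n] A s[of n] x by (intro emet_triangle[OF X]) (auto simp: closure_in_def)
    also have "\<dots> \<le> ennreal ((1/2)^n) + edist X (s n) x"
      using a(2) by (intro add_right_mono)
    finally show ?thesis .
  qed
  then have "(\<lambda>n. edist X (a n) x) \<longlonglongrightarrow> 0"
    by (intro tendsto_sandwich[OF _ _ tendsto_const 0] always_eventually allI) auto
  then show ?thesis
    unfolding closure_in_def using x a(1) by blast
qed

text \<open>A subspace of \<open>X\<close>, transported along an injection \<open>k\<close> to a set \<open>B\<close> of labels. This serves to
  realise a small subspace of a space on an arbitrary type as an object with points in \<open>'u\<close>.\<close>

definition pullback :: "'b set \<Rightarrow> ('b \<Rightarrow> 'a) \<Rightarrow> 'a emet \<Rightarrow> 'b emet" where
  "pullback B k X = \<lparr>Pts = B, edist = (\<lambda>p q. if p \<in> B \<and> q \<in> B then edist X (k p) (k q) else 0)\<rparr>"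

lemma Pts_pullback [simp]: "Pts (pullback B k X) = B"
  by (simp add: pullback_def)

lemma edist_pullback: "p \<in> B \<Longrightarrow> q \<in> B \<Longrightarrow> edist (pullback B k X) p q = edist X (k p) (k q)"
  by (simp add: pullback_def)

lemma is_emet_pullback:
  assumes X: "is_emet X" and k: "inj_on k B" "k ` B \<subseteq> Pts X"
  shows "is_emet (pullback B k X)"
  unfolding is_emet_def
proof (intro conjI ballI allI impI)
  fix p q assume "p \<in> Pts (pullback B k X)" "q \<in> Pts (pullback B k X)"
  then have pq: "p \<in> B" "q \<in> B" "k p \<in> Pts X" "k q \<in> Pts X" using k by auto
  show "edist (pullback B k X) p q = 0 \<longleftrightarrow> p = q"
    using pq emet_eq[OF X pq(3,4)] k(1) X by (auto simp: edist_pullback inj_on_def)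
  show "edist (pullback B k X) p q = edist (pullback B k X) q p"
    using pq emet_sym[OF X, of "k p" "k q"] by (simp add: edist_pullback)
  fix r assume "r \<in> Pts (pullback B k X)"
  then show "edist (pullback B k X) p r \<le> edist (pullback B k X) p q + edist (pullback B k X) q r"
    using pq emet_triangle[OF X pq(3,4), of "k r"] k by (auto simp: edist_pullback)
qed (auto simp: pullback_def)

lemma emet_complete_pullback:
  assumes complete: "emet_complete X" and k: "k ` B \<subseteq> Pts X"
    and closed: "\<And>s x. range s \<subseteq> k ` B \<Longrightarrow> x \<in> Pts X \<Longrightarrow> (\<lambda>n. edist X (s n) x) \<longlonglongrightarrow> 0 \<Longrightarrow> x \<in> k ` B"
  shows "emet_complete (pullback B k X)"
  unfolding emet_complete_def
proof (intro allI impI)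
  fix \<sigma> assume \<sigma>: "emet_Cauchy (pullback B k X) \<sigma>"
  then have \<sigma>B: "\<sigma> n \<in> B" for n by (auto simp: emet_Cauchy_def)
  have "emet_Cauchy X (\<lambda>n. k (\<sigma> n))"
    using \<sigma> \<sigma>B k unfolding emet_Cauchy_def by (auto simp: edist_pullback)
  then obtain x where x: "x \<in> Pts X" "(\<lambda>n. edist X (k (\<sigma> n)) x) \<longlonglongrightarrow> 0"
    using complete unfolding emet_complete_def by blast
  moreover have "x \<in> k ` B"
    using x \<sigma>B by (intro closed[of "\<lambda>n. k (\<sigma> n)"]) auto
  ultimately show "\<exists>p \<in> Pts (pullback B k X). (\<lambda>n. edist (pullback B k X) (\<sigma> n) p) \<longlonglongrightarrow> 0"
    using \<sigma>B by (auto simp: edist_pullback)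
qed


section \<open>The category of complete metric spaces\<close>

abbreviation map_of_arr :: "'u emet \<times> ('u \<Rightarrow> 'u) \<times> 'u emet \<Rightarrow> 'u \<Rightarrow> 'u" where
  "map_of_arr a \<equiv> fst (snd a)"

lemma CMet_simps [simp]:
  "Dom CMet a = fst a" "Cod CMet a = snd (snd a)"
  "Idt CMet X = (X, (\<lambda>x \<in> Pts X. x), X)"
  "Comp CMet b a = (fst a, compose (Pts (fst a)) (map_of_arr b) (map_of_arr a), snd (snd b))"
  by (auto simp: CMet_def Let_def split: prod.splits)

lemma Obj_CMet:
  "X \<in> Obj (CMet :: ('u emet, _) cat) \<longleftrightarrow> is_emet X \<and> emet_complete X \<and> small TYPE('u) (Pts X)"
  by (simp add: CMet_def Let_def)

lemma Hom_CMet: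
  "a \<in> Hom CMet X Y \<longleftrightarrow> fst a = X \<and> snd (snd a) = Y \<and> X \<in> Obj CMet \<and> Y \<in> Obj CMet \<and>
    map_of_arr a \<in> Pts X \<rightarrow>\<^sub>E Pts Y \<and>
    (\<forall>x \<in> Pts X. \<forall>y \<in> Pts X. edist Y (map_of_arr a x) (map_of_arr a y) \<le> edist X x y)"
  unfolding Hom_def by (cases a) (auto simp: CMet_def Let_def)

lemma map_of_arr_in: "a \<in> Hom CMet X Y \<Longrightarrow> x \<in> Pts X \<Longrightarrow> map_of_arr a x \<in> Pts Y"
  unfolding Hom_CMet by auto

lemma map_of_arr_nonexp:
  "a \<in> Hom CMet X Y \<Longrightarrow> x \<in> Pts X \<Longrightarrow> y \<in> Pts X \<Longrightarrow>
    edist Y (map_of_arr a x) (map_of_arr a y) \<le> edist X x y"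
  unfolding Hom_CMet by auto

lemma Hom_CMet_eqI:
  assumes "a \<in> Hom CMet X Y" "b \<in> Hom CMet X Y" "\<And>x. x \<in> Pts X \<Longrightarrow> map_of_arr a x = map_of_arr b x"
  shows "a = b"
proof -
  have "map_of_arr a = map_of_arr b"
    using assms unfolding Hom_CMet by (intro PiE_ext[of _ "Pts X" "\<lambda>_. Pts Y"]) auto
  then show ?thesis using assms(1,2) unfolding Hom_CMet by (simp add: prod_eq_iff)
qed

interpretation CMet: category CMet
proof
  fix a assume "a \<in> Arr CMet"
  then have a: "a \<in> Hom CMet (Dom CMet a) (Cod CMet a)" by (simp add: Hom_def)
  then show "Dom CMet a \<in> Obj CMet" "Cod CMet a \<in> Obj CMet" by (simp_all add: Hom_CMet)
next
  fix X :: "'u emet" assume "X \<in> Obj CMet"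
  then show "Idt CMet X \<in> Hom CMet X X" by (auto simp: Hom_CMet)
next
  fix a b and X Y Z :: "'u emet" assume a: "a \<in> Hom CMet X Y" and b: "b \<in> Hom CMet Y Z"
  have "edist Z (map_of_arr b (map_of_arr a x)) (map_of_arr b (map_of_arr a y)) \<le> edist X x y"
    if "x \<in> Pts X" "y \<in> Pts X" for x y
    using map_of_arr_nonexp[OF b map_of_arr_in[OF a] map_of_arr_in[OF a]] map_of_arr_nonexp[OF a] that
    by (meson order_trans)
  then show "b \<cdot>\<^bsub>CMet\<^esub> a \<in> Hom CMet X Z"
    using a b map_of_arr_in[OF b map_of_arr_in[OF a]] by (simp add: Hom_CMet compose_def)
next
  fix a and X Y :: "'u emet" assume a: "a \<in> Hom CMet X Y"
  then have "map_of_arr a \<in> extensional (Pts X)" "map_of_arr a \<in> Pts X \<rightarrow> Pts Y"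
    by (auto simp: Hom_CMet PiE_def)
  then show "a \<cdot>\<^bsub>CMet\<^esub> Idt CMet X = a" "Idt CMet Y \<cdot>\<^bsub>CMet\<^esub> a = a"
    using a by (auto simp: Hom_CMet prod_eq_iff compose_Id Id_compose)
next
  fix a b c and W X Y Z :: "'u emet"
  assume "a \<in> Hom CMet W X" "b \<in> Hom CMet X Y" "c \<in> Hom CMet Y Z"
  then show "(c \<cdot>\<^bsub>CMet\<^esub> b) \<cdot>\<^bsub>CMet\<^esub> a = c \<cdot>\<^bsub>CMet\<^esub> (b \<cdot>\<^bsub>CMet\<^esub> a)"
    by (auto simp: Hom_CMet compose_def fun_eq_iff)
qed

lemma map_of_arr_Comp [simp]:
  "x \<in> Pts (fst a) \<Longrightarrow> map_of_arr (b \<cdot>\<^bsub>CMet\<^esub> a) x = map_of_arr b (map_of_arr a x)"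
  by (simp add: compose_def)

text \<open>
  The vertex of the colimit is the closure \<open>Z\<close> of the image of the diagram in the product of all
  cocone vertices, transported to \<open>'u\<close>. A cocone is a coordinate of the product, and evaluation at this
  coordinate is the mediating map. Whatever holds in each cocone, such as compatibility with the
  arrows of the diagram, holds for the image of the diagram coordinatewise.
\<close>

theorem has_colimits_CMet:
  fixes J :: "('j, 'k) cat"
  assumes U: "is_universe TYPE('u)" and J: "small_category TYPE('u) J"
  shows "has_colimits_of_shape J (CMet :: ('u emet, _) cat)"
  unfolding has_colimits_of_shape_def
proof (intro allI impI)
  fix D :: "('j, 'k, 'u emet, 'u emet \<times> ('u \<Rightarrow> 'u) \<times> 'u emet) fnctr"
  assume D: "is_fnctr J CMet D"
  interpret D: is_fnctr J CMet D by (fact D)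
  define K where "K = {(c, \<mu>). is_cocone J CMet D c \<mu>}"
  define P where "P = sup_product K fst"
  define \<iota> where "\<iota> j x = (\<lambda>k\<in>K. map_of_arr (snd k j) x)" for j x
  define A where "A = (\<Union>j\<in>Obj J. \<iota> j ` Pts (Fob D j))"
  have K_obj: "fst k \<in> Obj CMet" and K_leg: "\<And>j. j \<in> Obj J \<Longrightarrow> snd k j \<in> Hom CMet (Fob D j) (fst k)"
    and K_nat: "\<And>u. u \<in> Arr J \<Longrightarrow> snd k (Cod J u) \<cdot>\<^bsub>CMet\<^esub> Far D u = snd k (Dom J u)"
    if "k \<in> K" for k
    using that unfolding K_def is_cocone_def by auto
  have P: "is_emet P" "emet_complete P"
    unfolding P_def using K_obj
    by (auto intro!: is_emet_sup_product emet_complete_sup_product simp: Obj_CMet)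
  have Pts_P: "Pts P = (\<Pi>\<^sub>E k\<in>K. Pts (fst k))" by (simp add: P_def)
  have \<iota>_Pts: "\<iota> j x \<in> Pts P" if "j \<in> Obj J" "x \<in> Pts (Fob D j)" for j x
    using map_of_arr_in[OF K_leg] that by (auto simp: Pts_P \<iota>_def)
  then have A: "A \<subseteq> Pts P" by (auto simp: A_def)
  have "small TYPE('u) A"
    unfolding A_def using D.Fob_in J
    by (intro small_UN[OF U] small_image) (auto simp: small_category_def Obj_CMet)
  define Z where "Z = closure_in P A"
  have AZ: "A \<subseteq> Z" unfolding Z_def by (rule subset_closure_in[OF P(1) A])
  have ZP: "Z \<subseteq> Pts P" by (auto simp: Z_def closure_in_def)
  have "small TYPE('u) Z"
    unfolding Z_def by (rule small_closure_in[OF U P(1) A \<open>small TYPE('u) A\<close>])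
  from small_embeds[OF this] obtain g :: "_ \<Rightarrow> 'u" where g: "inj_on g Z" .
  \<comment> \<open>The space \<open>Z\<close> is relabelled by the points of \<open>B\<close>; here \<open>k\<close> returns the point that a label stands for.\<close>
  define B where "B = g ` Z"
  define k where "k = inv_into Z g"
  have kg: "k (g z) = z" if "z \<in> Z" for z using g that by (simp add: k_def)
  have kB: "k ` B = Z" "inj_on k B"
    unfolding B_def inj_on_def using kg by (auto simp: image_image)
  define c where "c = pullback B k P"
  have "x \<in> k ` B" if "range s \<subseteq> k ` B" "x \<in> Pts P" "(\<lambda>n. edist P (s n) x) \<longlonglongrightarrow> 0" for s x
    using closure_in_closed[OF P(1) A _ that(2,3)] that(1) unfolding kB Z_def by blast
  then have "emet_complete c"
    unfolding c_def using P(2) kB(1) ZP by (intro emet_complete_pullback) auto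
  moreover have "is_emet c"
    unfolding c_def using P(1) kB ZP by (intro is_emet_pullback) auto
  moreover have "small TYPE('u) (Pts c)"
    unfolding c_def B_def using small_image[OF \<open>small TYPE('u) Z\<close>] by simp
  ultimately have c: "c \<in> Obj CMet" by (simp add: Obj_CMet)
  have Pts_c: "Pts c = B" by (simp add: c_def)
  have edist_c: "edist c p q = edist P (k p) (k q)" if "p \<in> B" "q \<in> B" for p q
    unfolding c_def using that by (rule edist_pullback)
  define \<mu> where "\<mu> j = (Fob D j, (\<lambda>x\<in>Pts (Fob D j). g (\<iota> j x)), c)" for j
  have \<iota>Z: "\<iota> j x \<in> Z" if "j \<in> Obj J" "x \<in> Pts (Fob D j)" for j x
    using AZ that by (auto simp: A_def)
  then have \<iota>B: "g (\<iota> j x) \<in> B" "k (g (\<iota> j x)) = \<iota> j x" if "j \<in> Obj J" "x \<in> Pts (Fob D j)" for j x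
    using that kg by (auto simp: B_def)
  have \<mu>: "\<mu> j \<in> Hom CMet (Fob D j) c" if j: "j \<in> Obj J" for j
  proof -
    have "edist P (\<iota> j x) (\<iota> j y) \<le> edist (Fob D j) x y" if x: "x \<in> Pts (Fob D j)" and y: "y \<in> Pts (Fob D j)" for x y
    proof -
      have "(SUP i\<in>K. edist (fst i) (\<iota> j x i) (\<iota> j y i)) \<le> edist (Fob D j) x y"
        using map_of_arr_nonexp[OF K_leg x y] j by (intro SUP_least) (simp add: \<iota>_def)
      then show ?thesis
        using edist_sup_product[of "\<iota> j x" K fst "\<iota> j y"] \<iota>_Pts[OF j x] \<iota>_Pts[OF j y]
        by (simp add: P_def)
    qed
    then show ?thesis
      unfolding Hom_CMet using D.Fob_in[OF j] c \<iota>B[OF j] by (simp add: \<mu>_def Pts_c edist_c)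
  qed
  have "is_cocone J CMet D c \<mu>"
    unfolding is_cocone_def
  proof (intro conjI ballI D c \<mu>)
    fix u assume u: "u \<in> Arr J"
    have j: "Dom J u \<in> Obj J" "Cod J u \<in> Obj J" and Du: "Far D u \<in> Hom CMet (Fob D (Dom J u)) (Fob D (Cod J u))"
      using u D.A.Dom_in D.A.Cod_in D.Far_in by (auto simp: Arr_Hom[of u])
    have Du_fst: "fst (Far D u) = Fob D (Dom J u)" using Du by (simp add: Hom_CMet)
    show "\<mu> (Cod J u) \<cdot>\<^bsub>CMet\<^esub> Far D u = \<mu> (Dom J u)"
    proof (rule Hom_CMet_eqI[OF CMet.Comp_in[OF Du \<mu>[OF j(2)]] \<mu>[OF j(1)]])
      fix x assume x: "x \<in> Pts (Fob D (Dom J u))"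
      have Dux: "map_of_arr (Far D u) x \<in> Pts (Fob D (Cod J u))" by (rule map_of_arr_in[OF Du x])
      have "map_of_arr (snd i (Cod J u)) (map_of_arr (Far D u) x) = map_of_arr (snd i (Dom J u)) x"
        if "i \<in> K" for i
        using map_of_arr_Comp[of x "Far D u" "snd i (Cod J u)"] x
        unfolding K_nat[OF that u] Du_fst by simp
      then have "\<iota> (Cod J u) (map_of_arr (Far D u) x) = \<iota> (Dom J u) x"
        by (auto simp: \<iota>_def)
      then show "map_of_arr (\<mu> (Cod J u) \<cdot>\<^bsub>CMet\<^esub> Far D u) x = map_of_arr (\<mu> (Dom J u)) x"
        using x Dux Du_fst by (simp add: \<mu>_def compose_def)
    qed
  qed
  moreover have "\<exists>!h. h \<in> Hom CMet c c' \<and> (\<forall>j \<in> Obj J. h \<cdot>\<^bsub>CMet\<^esub> \<mu> j = \<mu>' j)"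
    if cocone: "is_cocone J CMet D c' \<mu>'" for c' \<mu>'
  proof (rule ex_ex1I)
    have i: "(c', \<mu>') \<in> K" using cocone by (simp add: K_def)
    define h where "h = (c, (\<lambda>p\<in>B. k p (c', \<mu>')), c')"
    have kp: "k p \<in> Pts P" if "p \<in> B" for p using kB ZP that by blast
    have "k p (c', \<mu>') \<in> Pts c'" if "p \<in> B" for p
      using kp[OF that] i unfolding Pts_P by (auto dest: PiE_mem)
    moreover have "edist c' (k p (c', \<mu>')) (k q (c', \<mu>')) \<le> edist P (k p) (k q)"
      if "p \<in> B" "q \<in> B" for p q
      using edist_sup_product_upper[of "k p" K fst "k q", OF _ _ i] kp[OF that(1)] kp[OF that(2)]
      by (simp add: P_def)
    ultimately have h: "h \<in> Hom CMet c c'"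
      unfolding Hom_CMet using c K_obj[OF i] by (simp add: h_def Pts_c edist_c)
    have "h \<cdot>\<^bsub>CMet\<^esub> \<mu> j = \<mu>' j" if j: "j \<in> Obj J" for j
    proof (rule Hom_CMet_eqI[OF CMet.Comp_in[OF \<mu>[OF j] h]])
      show "\<mu>' j \<in> Hom CMet (Fob D j) c'" using K_leg[OF i j] by simp
      fix x assume x: "x \<in> Pts (Fob D j)"
      then show "map_of_arr (h \<cdot>\<^bsub>CMet\<^esub> \<mu> j) x = map_of_arr (\<mu>' j) x"
        using \<iota>B[OF j x] i by (simp add: h_def \<mu>_def compose_def \<iota>_def)
    qed
    then show "\<exists>h. h \<in> Hom CMet c c' \<and> (\<forall>j \<in> Obj J. h \<cdot>\<^bsub>CMet\<^esub> \<mu> j = \<mu>' j)"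
      using h by blast
  next
    fix h h'
    assume "h \<in> Hom CMet c c' \<and> (\<forall>j \<in> Obj J. h \<cdot>\<^bsub>CMet\<^esub> \<mu> j = \<mu>' j)"
      and "h' \<in> Hom CMet c c' \<and> (\<forall>j \<in> Obj J. h' \<cdot>\<^bsub>CMet\<^esub> \<mu> j = \<mu>' j)"
    then have h: "h \<in> Hom CMet c c'" and h': "h' \<in> Hom CMet c c'"
      and hh': "\<And>j. j \<in> Obj J \<Longrightarrow> h \<cdot>\<^bsub>CMet\<^esub> \<mu> j = h' \<cdot>\<^bsub>CMet\<^esub> \<mu> j"
      by auto
    \<comment> \<open>Both maps are determined by the legs on the dense set \<open>A\<close>, hence everywhere by continuity.\<close>
    have agree: "map_of_arr h (g a) = map_of_arr h' (g a)" if "a \<in> A" for a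
    proof -
      obtain j x where jx: "j \<in> Obj J" "x \<in> Pts (Fob D j)" "a = \<iota> j x"
        using \<open>a \<in> A\<close> by (auto simp: A_def)
      have "map_of_arr (h \<cdot>\<^bsub>CMet\<^esub> \<mu> j) x = map_of_arr (h' \<cdot>\<^bsub>CMet\<^esub> \<mu> j) x" using hh'[OF jx(1)] by simp
      then show ?thesis using jx by (simp add: \<mu>_def compose_def)
    qed
    show "h = h'"
    proof (rule Hom_CMet_eqI[OF h h'])
      fix p assume p: "p \<in> Pts c"
      then have pB: "p \<in> B" by (simp add: Pts_c)
      then have "k p \<in> Z" using kB by blast
      then obtain s where s: "range s \<subseteq> A" "(\<lambda>n. edist P (s n) (k p)) \<longlonglongrightarrow> 0"
        by (auto simp: Z_def closure_in_def)
      define q where "q n = g (s n)" for n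
      have sA: "s n \<in> A" for n using s(1) by blast
      have q: "q n \<in> Pts c" "k (q n) = s n" for n
        using sA[of n] AZ kg by (auto simp: q_def Pts_c B_def)
      have lim: "(\<lambda>n. edist c (q n) p) \<longlonglongrightarrow> 0"
        using s(2) q pB by (simp add: edist_c Pts_c)
      have lim_f: "(\<lambda>n. edist c' (map_of_arr f (q n)) (map_of_arr f p)) \<longlonglongrightarrow> 0"
        if f: "f \<in> Hom CMet c c'" for f
        using map_of_arr_nonexp[OF f q(1) p]
        by (intro tendsto_sandwich[OF _ _ tendsto_const lim] always_eventually allI) auto
      have "is_emet c'" using h by (simp add: Hom_CMet Obj_CMet)
      then show "map_of_arr h p = map_of_arr h' p"
        using lim_f[OF h] lim_f[OF h'] agree[OF sA] map_of_arr_in[OF h p] map_of_arr_in[OF h' p]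
          map_of_arr_in[OF h q(1)]
        by (intro limit_unique[of c' "\<lambda>n. map_of_arr h (q n)"]) (auto simp: q_def)
    qed
  qed
  ultimately have "is_colimit J CMet D c \<mu>" by (simp add: is_colimit_def)
  then show "\<exists>c \<mu>. is_colimit J CMet D c \<mu>" by blast
qed


section \<open>Path spaces as a coreflection\<close>

text \<open>The counit is the identity on points, so a section of it must be the identity as well; it is
  non-expansive exactly when path distances do not exceed distances.\<close>

interpretation path_spaces: coreflective_subcategory CMet "{X. is_path_emet X}" path_space
  "\<lambda>X. (path_space X, (\<lambda>x \<in> Pts X. x), X)"
proof
  fix X :: "'u emet" assume X: "X \<in> Obj CMet"
  then have eX: "is_emet X" by (simp add: Obj_CMet)
  show PX: "path_space X \<in> Obj CMet \<inter> {X. is_path_emet X}"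
    using X by (simp add: Obj_CMet is_emet_path_space emet_complete_path_space is_path_emet_path_space)
  show "(path_space X, (\<lambda>x \<in> Pts X. x), X) \<in> Hom CMet (path_space X) X"
    using X PX edist_le_path_dist[OF eX] by (auto simp: Hom_CMet edist_path_space)
next
  fix f and P X :: "'u emet"
  let ?e = "(path_space X, (\<lambda>x \<in> Pts X. x), X)"
  assume f: "f \<in> Hom CMet P X" and P: "P \<in> {X. is_path_emet X}"
  then have X: "X \<in> Obj CMet" "P \<in> Obj CMet" and eX: "is_emet X" and eP: "is_emet P"
    by (auto simp: Hom_CMet Obj_CMet)
  have PX: "path_space X \<in> Obj CMet"
    using X by (simp add: Obj_CMet is_emet_path_space emet_complete_path_space)
  have "path_dist X (map_of_arr f x) (map_of_arr f y) \<le> edist P x y"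
    if "x \<in> Pts P" "y \<in> Pts P" for x y
    using path_dist_image[OF eP eX, of "map_of_arr f" x y] map_of_arr_in[OF f] map_of_arr_nonexp[OF f] P that
    by (auto simp: is_path_emet_def)
  then have g: "(P, map_of_arr f, path_space X) \<in> Hom CMet P (path_space X)"
    using f PX map_of_arr_in[OF f] by (simp add: Hom_CMet edist_path_space)
  show "\<exists>!g. g \<in> Hom CMet P (path_space X) \<and> ?e \<cdot>\<^bsub>CMet\<^esub> g = f"
  proof (rule ex1I)
    have "compose (Pts P) (\<lambda>x \<in> Pts X. x) (map_of_arr f) = map_of_arr f"
      using f by (intro Id_compose) (auto simp: Hom_CMet PiE_def)
    then show "(P, map_of_arr f, path_space X) \<in> Hom CMet P (path_space X) \<and>
        ?e \<cdot>\<^bsub>CMet\<^esub> (P, map_of_arr f, path_space X) = f"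
      using g f by (simp add: Hom_CMet prod_eq_iff)
    fix h assume h: "h \<in> Hom CMet P (path_space X) \<and> ?e \<cdot>\<^bsub>CMet\<^esub> h = f"
    then have hH: "h \<in> Hom CMet P (path_space X)" and eh: "?e \<cdot>\<^bsub>CMet\<^esub> h = f" by auto
    show "h = (P, map_of_arr f, path_space X)"
    proof (rule Hom_CMet_eqI[OF hH g])
      fix x assume x: "x \<in> Pts P"
      have "fst h = P" using hH by (simp add: Hom_CMet)
      then show "map_of_arr h x = map_of_arr (P, map_of_arr f, path_space X) x"
        using x map_of_arr_in[OF hH x] unfolding eh[symmetric] by (simp add: compose_def)
    qed
  qed
next
  fix s and X :: "'u emet"
  let ?e = "(path_space X, (\<lambda>x \<in> Pts X. x), X)"
  assume s: "s \<in> Hom CMet X (path_space X)" and es: "?e \<cdot>\<^bsub>CMet\<^esub> s = Idt CMet X"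
  then have eX: "is_emet X" and sX: "fst s = X" by (auto simp: Hom_CMet Obj_CMet)
  have "map_of_arr s x = x" if x: "x \<in> Pts X" for x
    using arg_cong[OF es, of "\<lambda>a. map_of_arr a x"] map_of_arr_in[OF s x] x sX by (simp add: compose_def)
  then have "path_dist X x y \<le> edist X x y" if "x \<in> Pts X" "y \<in> Pts X" for x y
    using map_of_arr_nonexp[OF s that] that by (simp add: edist_path_space)
  then show "X \<in> {X. is_path_emet X}"
    using eX edist_le_path_dist[OF eX] by (auto simp: is_path_emet_def intro: antisym)
qed

theorem theorem3p5:
  assumes "is_universe TYPE('u)"
  shows "(\<forall>J :: ('j, 'k) cat. category J \<longrightarrow>
            closed_under_colimits_of_shape J (CPMet :: ('u emet, _) cat) CMet) \<and>
         (\<forall>J :: ('j, 'k) cat. small_category TYPE('u) J \<longrightarrow>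
            has_colimits_of_shape J (CPMet :: ('u emet, _) cat)) \<and>
         comonadic (CPMet :: ('u emet, _) cat) CMet id_fnctr"
  unfolding CPMet_def
  using path_spaces.closed_under_colimits path_spaces.comonadic_inclusion
    CMet.has_colimits_full_subcategory[OF has_colimits_CMet[OF assms] path_spaces.closed_under_colimits]
  by blast

end
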